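(* Let $X=\{X_n\}_{n\in\mathbb{Z}}$ be a square integrable stationary IDp process of distribution $\mathbb{P}$ such that, up to a possible translation or a change of sign, $X_0$ is nonnegative (i.e. there are $\varepsilon\in\{-1,1\}$ and $d\in\mathbb{R}$ with $\varepsilon X_0+d\ge0$ almost surely). Let $\sigma$ be the spectral measure of $X_0-\mathbb{E}[X_0]$. Then: (i) $\mathbb{P}$ is ergodic if and only if $\sigma\{0\}=0$; (ii) $\mathbb{P}$ is mixing if and only if $\sigma$ is Rajchman.
   Context: A process $X=\{X_n\}_{n\in\mathbb{Z}}$ is infinitely divisible if for every integer $k\ge1$ it equals in distribution the sum of $k$ i.i.d. processes. A stationary infinitely divisible process has, for all finitely supported $a\in\mathbb{R}^{\mathbb{Z}}$, $$\mathbb{E}[\exp i\langle a,X\rangle]=\exp\Big[-\tfrac12\langle Ra,a\rangle+i\langle a,b_\infty\rangle+\int_{\mathbb{R}^{\mathbb{Z}}}(e^{i\langle a,x\rangle}-1-i\langle c(x),a\rangle)\,Q(dx)\Big],$$ with $R$ the covariance of a centered stationary Gaussian process, $b_\infty$ a constant sequence, $c(x)_i=\max(-1,\min(1,x_i))$, and $Q$ a $\sigma$-finite shift-invariant measure on $\mathbb{R}^{\mathbb{Z}}$ with $Q\{0\}=0$ and $\int(x_0^2\wedge1)\,Q(dx)<\infty$ (the L\'evy measure). It is called IDp if it has no Gaussian part ($R=0$). Ergodicity and mixing of $\mathbb{P}$ refer to the system $(\mathbb{R}^{\mathbb{Z}},\mathcal{B}^{\otimes\mathbb{Z}},\mathbb{P},T)$,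 $T$ the shift; mixing means $\mathbb{P}(A\cap T^{-n}B)\to\mathbb{P}(A)\mathbb{P}(B)$ for all $A,B$. The spectral measure of $f\in L^2(\mathbb{P})$ is the finite measure $\sigma_f$ on $[-\pi,\pi[$ with $\int_{[-\pi,\pi[}e^{inx}\sigma_f(dx)=\langle f\circ T^n,f\rangle_{L^2(\mathbb{P})}$ for all $n\in\mathbb{Z}$. A finite measure $\sigma$ on $[-\pi,\pi[$ is Rajchman if $\hat\sigma(n)=\int e^{inx}\sigma(dx)\to0$ as $|n|\to\infty$. *)

theory Defs
  imports "HOL-Probability.Probability"
begin

definition path_space :: "(int \<Rightarrow> real) measure" where
  "path_space = (\<Pi>\<^sub>M i\<in>UNIV. borel)"

definition process_law :: "'a measure \<Rightarrow> (int \<Rightarrow> 'a \<Rightarrow> real) \<Rightarrow> (int \<Rightarrow> real) measure" where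
  "process_law M X = distr M path_space (\<lambda>\<omega> n. X n \<omega>)"

text \<open>\<open>shift n\<close> is the power \<open>T\<^sup>n\<close>, for \<open>n \<in> \<int>\<close>, of the shift \<open>T = shift 1\<close>.\<close>

definition shift :: "int \<Rightarrow> (int \<Rightarrow> real) \<Rightarrow> (int \<Rightarrow> real)" where
  "shift n x = (\<lambda>k. x (k + n))"

lemma shift_one_funpow: "shift 1 ^^ n = shift (int n)"
  by (induction n) (auto simp: shift_def fun_eq_iff add.assoc)

definition shift_invariant :: "(int \<Rightarrow> real) measure \<Rightarrow> bool" where
  "shift_invariant \<mu> \<longleftrightarrow> distr \<mu> path_space (shift 1) = \<mu>"

definition ergodic_law :: "(int \<Rightarrow> real) measure \<Rightarrow> bool" where
  "ergodic_law P \<longleftrightarrow>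
     (\<forall>A\<in>sets P. shift 1 -` A \<inter> space P = A \<longrightarrow> measure P A = 0 \<or> measure P A = 1)"

definition mixing_law :: "(int \<Rightarrow> real) measure \<Rightarrow> bool" where
  "mixing_law P \<longleftrightarrow>
     (\<forall>A\<in>sets P. \<forall>B\<in>sets P.
        (\<lambda>n. measure P (A \<inter> (shift (int n) -` B \<inter> space P))) \<longlonglongrightarrow> measure P A * measure P B)"

text \<open>The \<open>k\<close> i.i.d. processes are realised canonically, as the coordinates of the
  \<open>k\<close>-fold product of their common law \<open>\<mu>\<close>.\<close>

definition infinitely_divisible :: "(int \<Rightarrow> real) measure \<Rightarrow> bool" where
  "infinitely_divisible P \<longleftrightarrow>
     (\<forall>k\<ge>1::nat. \<exists>\<mu>. prob_space \<mu> \<and> sets \<mu> = sets path_space \<and>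
        P = distr (\<Pi>\<^sub>M j\<in>{..<k}. \<mu>) path_space (\<lambda>Y n. \<Sum>j<k. Y j n))"

text \<open>\<open>pairing a x\<close> is \<open>\<langle>a, x\<rangle>\<close>; it is only used for finitely supported \<open>a\<close>.\<close>

definition pairing :: "(int \<Rightarrow> real) \<Rightarrow> (int \<Rightarrow> real) \<Rightarrow> real" where
  "pairing a x = (\<Sum>i | a i \<noteq> 0. a i * x i)"

definition truncation :: "(int \<Rightarrow> real) \<Rightarrow> (int \<Rightarrow> real)" where
  "truncation x = (\<lambda>i. max (- 1) (min 1 (x i)))"

text \<open>Point masses count as (degenerate) Gaussian laws.\<close>

definition gaussian_real :: "real measure \<Rightarrow> bool" where
  "gaussian_real \<nu> \<longleftrightarrow>
     (\<exists>m s. s > 0 \<and> \<nu> = density lborel (\<lambda>x. ennreal (normal_density m s x))) \<or>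
     (\<exists>m. \<nu> = return borel m)"

definition stationary_gaussian_covariance :: "(int \<Rightarrow> int \<Rightarrow> real) \<Rightarrow> bool" where
  "stationary_gaussian_covariance R \<longleftrightarrow>
     (\<exists>G. prob_space G \<and> sets G = sets path_space \<and> shift_invariant G \<and>
        (\<forall>a. finite {i. a i \<noteq> 0} \<longrightarrow> gaussian_real (distr G borel (pairing a))) \<and>
        (\<forall>i. (\<integral>x. x i \<partial>G) = 0) \<and>
        (\<forall>i j. R i j = (\<integral>x. x i * x j \<partial>G)))"

definition levy_measure :: "(int \<Rightarrow> real) measure \<Rightarrow> bool" where
  "levy_measure Q \<longleftrightarrow>
     sets Q = sets path_space \<and> sigma_finite_measure Q \<and> shift_invariant Q \<and>
     emeasure Q {\<lambda>_. 0} = 0 \<and> (\<integral>\<^sup>+x. ennreal (min ((x 0)\<^sup>2) 1) \<partial>Q) < \<infinity>"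

text \<open>In \<open>levy_triplet P R b Q\<close> the real \<open>b\<close> stands for the constant drift sequence
  \<open>b\<^sub>\<infinity>\<close>, and \<open>pairing a (\<lambda>i. pairing a (R i))\<close> is \<open>\<langle>R a, a\<rangle>\<close>.\<close>

definition levy_triplet ::
  "(int \<Rightarrow> real) measure \<Rightarrow> (int \<Rightarrow> int \<Rightarrow> real) \<Rightarrow> real \<Rightarrow> (int \<Rightarrow> real) measure \<Rightarrow> bool" where
  "levy_triplet P R b Q \<longleftrightarrow>
     stationary_gaussian_covariance R \<and> levy_measure Q \<and>
     (\<forall>a. finite {i. a i \<noteq> 0} \<longrightarrow>
        (\<integral>x. iexp (pairing a x) \<partial>P) =
        exp (- complex_of_real (pairing a (\<lambda>i. pairing a (R i))) / 2
             + \<i> * complex_of_real (pairing a (\<lambda>_. b))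
             + (\<integral>x. iexp (pairing a x) - 1 - \<i> * complex_of_real (pairing a (truncation x)) \<partial>Q)))"

definition stationary_IDp :: "(int \<Rightarrow> real) measure \<Rightarrow> bool" where
  "stationary_IDp P \<longleftrightarrow>
     shift_invariant P \<and> infinitely_divisible P \<and> (\<exists>b Q. levy_triplet P (\<lambda>_ _. 0) b Q)"

definition circle_measure :: "real measure \<Rightarrow> bool" where
  "circle_measure \<sigma> \<longleftrightarrow>
     finite_measure \<sigma> \<and> sets \<sigma> = sets (restrict_space borel {-pi..<pi})"

text \<open>For a measure on \<open>[-\<pi>, \<pi>[\<close> the \<open>n\<close>-th Fourier coefficient is \<open>char \<sigma> n\<close>.\<close>

definition is_spectral_measure ::
  "(int \<Rightarrow> real) measure \<Rightarrow> ((int \<Rightarrow> real) \<Rightarrow> complex) \<Rightarrow> real measure \<Rightarrow> bool" where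
  "is_spectral_measure P f \<sigma> \<longleftrightarrow>
     f \<in> borel_measurable P \<and> integrable P (\<lambda>x. (cmod (f x))\<^sup>2) \<and> circle_measure \<sigma> \<and>
     (\<forall>n::int. char \<sigma> (of_int n) = (\<integral>x. f (shift n x) * cnj (f x) \<partial>P))"

definition rajchman :: "real measure \<Rightarrow> bool" where
  "rajchman \<sigma> \<longleftrightarrow>
     circle_measure \<sigma> \<and>
     ((\<lambda>n::int. char \<sigma> (of_int n)) \<longlongrightarrow> 0) (filtercomap (\<lambda>n::int. \<bar>n\<bar>) at_top)"

end

theory Submission
  imports Defs
begin

text \<open>Write \<open>X\<close> as a sum of \<open>k\<close> i.i.d. processes. Each summand, after a change of
  sign and adding \<open>d / k\<close>, is a nonnegative process \<open>Z\<close>, so the covariance of \<open>exp (i \<langle>a, Z\<rangle>)\<close> and \<open>exp (i \<langle>b, Z\<rangle>)\<close> is bounded by second moments of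
  \<open>Z\<close>. Since \<open>|z\<^sup>k - w\<^sup>k| \<le> k |z - w|\<close> on the unit disc, letting \<open>k\<close> tend to infinity gives the
  Newman-type inequality \<open>|E exp (i \<langle>a + b, X\<rangle>) - E exp (i \<langle>a, X\<rangle>) E exp (i \<langle>b, X\<rangle>)| \<le> \<Sum> |a i| |b j| Cov (X i, X j)\<close>.
  Hence decay of the covariances, in the ordinary or in the Cesaro sense, forces decay of the
  correlations of trigonometric polynomials, which are dense in \<open>L\<^sup>1\<close>; and the Cesaro limit of the
  covariances is the mass of the spectral measure at \<open>0\<close>. Conversely, mixing extends from sets to
  square integrable functions, and ergodicity enters through the mean ergodic theorem.\<close>

section \<open>Infinitely divisible laws with one-sided coordinates\<close>

text \<open>Applied to a nonnegative X itself, the estimate |e^(i t) - 1| \<le> |t| bounds the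
  covariance of two exponentials by E X X' + E X E X', which is Cov + 2 E X E X'; the excess does
  not decay with the lag. For a k-th root the means are k times smaller, so after the factor k of
  the power inequality the excess is of order 1 / k. One-sidedness enters through |Z| = Z: the bound
  then contains signed covariances, not moments of absolute values. The sign matters for ergodicity:
  Cesaro means of |Cov| would detect every atom of \<sigma>, while those of Cov detect the atom at 0
  alone. The inequality is linear in the covariances, so their signed averages pass through it. In
  the converse direction \<open>ergodic_law\<close> speaks of strictly invariant sets, whereas L^2
  limits are invariant almost surely; the gap is closed by replacing a set by the points that visit
  it infinitely often.\<close>

lemma abs_mult_le_sum_power2: "\<bar>u * v\<bar> \<le> u\<^sup>2 + v\<^sup>2" for u v :: real
  using sum_squares_bound[of "\<bar>u\<bar>" "\<bar>v\<bar>"] mult_nonneg_nonneg[of "\<bar>u\<bar>" "\<bar>v\<bar>"]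
  unfolding abs_mult power2_abs by linarith

lemma integrable_mult_square_integrable:
  fixes f g :: "'a \<Rightarrow> real"
  assumes [measurable]: "f \<in> borel_measurable M" "g \<in> borel_measurable M"
    and "integrable M (\<lambda>x. (f x)\<^sup>2)" "integrable M (\<lambda>x. (g x)\<^sup>2)"
  shows "integrable M (\<lambda>x. f x * g x)"
proof (rule Bochner_Integration.integrable_bound)
  show "integrable M (\<lambda>x. (f x)\<^sup>2 + (g x)\<^sup>2)" using assms by simp
  show "AE x in M. norm (f x * g x) \<le> norm ((f x)\<^sup>2 + (g x)\<^sup>2)"
    using abs_mult_le_sum_power2 by (auto intro!: AE_I2)
qed measurable

text \<open>Covariances do not see constants, so each exponential may be replaced by its difference
  from 1, and |e^(i t) - 1| \<le> |t| brings in the dominating functions. The product of means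
  enters with a plus sign, since only moduli are controlled.\<close>

lemma (in prob_space) cmod_covariance_iexp_le:
  fixes U V U' V' :: "'a \<Rightarrow> real"
  assumes [measurable]: "U \<in> borel_measurable M" "V \<in> borel_measurable M"
    and U': "integrable M U'" and V': "integrable M V'" and UV': "integrable M (\<lambda>x. U' x * V' x)"
    and leU: "AE x in M. \<bar>U x\<bar> \<le> U' x" and leV: "AE x in M. \<bar>V x\<bar> \<le> V' x"
  shows "cmod ((\<integral>x. iexp (U x + V x) \<partial>M) - (\<integral>x. iexp (U x) \<partial>M) * (\<integral>x. iexp (V x) \<partial>M))
    \<le> (\<integral>x. U' x * V' x \<partial>M) + (\<integral>x. U' x \<partial>M) * (\<integral>x. V' x \<partial>M)"
proof -
  define u v where "u x = iexp (U x) - 1" and "v x = iexp (V x) - 1" for x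
  have [measurable]: "u \<in> borel_measurable M" "v \<in> borel_measurable M"
    unfolding u_def v_def by measurable
  have le: "cmod (iexp t - 1) \<le> \<bar>t\<bar>" for t
    using iexp_approx1[of t 0] by simp
  have u: "AE x in M. cmod (u x) \<le> U' x" and v: "AE x in M. cmod (v x) \<le> V' x"
    using leU leV by (eventually_elim, auto simp: u_def v_def intro: order_trans[OF le])+
  \<comment> \<open>The bound 4 serves \<open>u\<close> and \<open>v\<close>, which are bounded by
    2, and \<open>u * v\<close> alike.\<close>
  have int_bdd: "integrable M f" if [measurable]: "f \<in> borel_measurable M" and "\<And>x. cmod (f x) \<le> 4" for f
    by (rule integrable_const_bound[of _ 4]) (use that in auto)
  have u2: "cmod (u x) \<le> 2" and v2: "cmod (v x) \<le> 2" for x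
    unfolding u_def v_def by (rule order_trans[OF norm_triangle_ineq4], simp)+
  have iu: "integrable M u" and iv: "integrable M v"
    by (intro int_bdd; (measurable; fail | rule order_trans[OF u2] order_trans[OF v2], simp))+
  have iuv: "integrable M (\<lambda>x. u x * v x)"
  proof (rule int_bdd)
    show "cmod (u x * v x) \<le> 4" for x
      unfolding norm_mult using mult_mono[OF u2[of x] v2[of x]] by simp
  qed measurable
  have eU: "(\<integral>x. iexp (U x) \<partial>M) = (\<integral>x. u x \<partial>M) + 1"
  proof -
    have "(\<integral>x. iexp (U x) \<partial>M) = (\<integral>x. u x + 1 \<partial>M)" by (simp add: u_def)
    then show ?thesis using iu by (simp add: prob_space)
  qed
  have eV: "(\<integral>x. iexp (V x) \<partial>M) = (\<integral>x. v x \<partial>M) + 1"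
  proof -
    have "(\<integral>x. iexp (V x) \<partial>M) = (\<integral>x. v x + 1 \<partial>M)" by (simp add: v_def)
    then show ?thesis using iv by (simp add: prob_space)
  qed
  have eUV: "(\<integral>x. iexp (U x + V x) \<partial>M) = (\<integral>x. u x * v x \<partial>M) + (\<integral>x. u x \<partial>M) + (\<integral>x. v x \<partial>M) + 1"
  proof -
    have "(\<integral>x. iexp (U x + V x) \<partial>M) = (\<integral>x. u x * v x + u x + v x + 1 \<partial>M)"
      by (intro Bochner_Integration.integral_cong refl)
         (simp add: u_def v_def exp_add distrib_left algebra_simps)
    then show ?thesis using iuv iu iv by (simp add: prob_space)
  qed
  have bound: "cmod (\<integral>x. f x \<partial>M) \<le> (\<integral>x. F x \<partial>M)"
    if "integrable M f" "integrable M F" "AE x in M. cmod (f x) \<le> F x" for f F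
    using that by (intro order_trans[OF integral_norm_bound] integral_mono_AE) auto
  have "AE x in M. cmod (u x * v x) \<le> U' x * V' x"
    using u v by eventually_elim
      (auto simp: norm_mult intro!: mult_mono intro: order_trans[OF norm_ge_zero])
  then have "cmod (\<integral>x. u x * v x \<partial>M) \<le> (\<integral>x. U' x * V' x \<partial>M)"
    by (rule bound[OF iuv UV'])
  moreover have "cmod (\<integral>x. u x \<partial>M) \<le> (\<integral>x. U' x \<partial>M)" "cmod (\<integral>x. v x \<partial>M) \<le> (\<integral>x. V' x \<partial>M)"
    using bound[OF iu U' u] bound[OF iv V' v] by auto
  then have "cmod ((\<integral>x. u x \<partial>M) * (\<integral>x. v x \<partial>M)) \<le> (\<integral>x. U' x \<partial>M) * (\<integral>x. V' x \<partial>M)"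
    unfolding norm_mult by (intro mult_mono) (auto intro: order_trans[OF norm_ge_zero])
  ultimately have "cmod ((\<integral>x. u x * v x \<partial>M) - (\<integral>x. u x \<partial>M) * (\<integral>x. v x \<partial>M))
      \<le> (\<integral>x. U' x * V' x \<partial>M) + (\<integral>x. U' x \<partial>M) * (\<integral>x. V' x \<partial>M)"
    by (intro order_trans[OF norm_triangle_ineq4] add_mono)
  then show ?thesis
    unfolding eU eV eUV by (simp add: algebra_simps)
qed

text \<open>Expanding the product leaves k diagonal terms E f g and k^2 - k off-diagonal ones, which
  factor by independence.\<close>

lemma (in prob_space) integral_PiM_sum_mult_sum:
  fixes f g :: "'a \<Rightarrow> real"
  assumes f: "integrable M f" and g: "integrable M g" and fg: "integrable M (\<lambda>x. f x * g x)"
  shows "(\<integral>Y. (\<Sum>j<k. f (Y j)) * (\<Sum>j<k. g (Y j)) \<partial>(\<Pi>\<^sub>M j\<in>{..<k}. M))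
    = real k * (\<integral>x. f x * g x \<partial>M) + (real k * real k - real k) * ((\<integral>x. f x \<partial>M) * (\<integral>x. g x \<partial>M))"
    (is "integral\<^sup>L ?PM _ = _")
proof -
  interpret PS: product_sigma_finite "\<lambda>_::nat. M" by standard
  \<comment> \<open>\<open>h p q r\<close> is the factor of \<open>f (Y p) * g (Y q)\<close> at
    coordinate r. Written as a full product over the coordinates, the term falls under one product
    formula for p = q and p \<noteq> q.\<close>
  define h where "h p q r x = (if r = p then (if r = q then f x * g x else f x) else if r = q then g x else 1)"
    for p q r :: nat and x
  have ih: "integrable M (h p q r)" for p q r
    unfolding h_def using f g fg by (cases "r = p"; cases "r = q") auto
  have split: "(\<Prod>r<k. h p q r (z r)) = f (z p) * g (z q)" if "p < k" "q < k" for p q and z :: "nat \<Rightarrow> 'a"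
  proof -
    have "(\<Prod>r<k. h p q r (z r)) = (\<Prod>r<k. (if r = p then f (z r) else 1) * (if r = q then g (z r) else 1))"
      by (intro prod.cong) (auto simp: h_def)
    then show ?thesis using that by (simp add: prod.distrib)
  qed
  have int: "integrable ?PM (\<lambda>Y. f (Y p) * g (Y q))"
    and eq: "(\<integral>Y. f (Y p) * g (Y q) \<partial>?PM)
      = (if p = q then (\<integral>x. f x * g x \<partial>M) else (\<integral>x. f x \<partial>M) * (\<integral>x. g x \<partial>M))"
    if pq: "p < k" "q < k" for p q
  proof -
    show "integrable ?PM (\<lambda>Y. f (Y p) * g (Y q))"
      using PS.product_integrable_prod[of "{..<k}" "h p q"] ih split[OF pq] by simp
    have "(\<integral>Y. f (Y p) * g (Y q) \<partial>?PM) = (\<Prod>r<k. \<integral>x. h p q r x \<partial>M)"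
      using PS.product_integral_prod[of "{..<k}" "h p q"] ih split[OF pq] by simp
    also have "\<dots> = (\<Prod>r<k. if r = p then (if p = q then (\<integral>x. f x * g x \<partial>M) else (\<integral>x. f x \<partial>M))
        else if r = q then (\<integral>x. g x \<partial>M) else 1)"
      by (intro prod.cong) (auto simp: h_def prob_space)
    also have "\<dots> = (if p = q then (\<integral>x. f x * g x \<partial>M) else (\<integral>x. f x \<partial>M) * (\<integral>x. g x \<partial>M))"
    proof (cases "p = q")
      case True
      then have "(\<Prod>r<k. if r = p then (if p = q then (\<integral>x. f x * g x \<partial>M) else (\<integral>x. f x \<partial>M))
          else if r = q then (\<integral>x. g x \<partial>M) else 1) = (\<Prod>r<k. if r = q then (\<integral>x. f x * g x \<partial>M) else 1)"
        by (intro prod.cong) auto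
      then show ?thesis using pq True by simp
    next
      case False
      have "(\<Prod>r<k. if r = p then (\<integral>x. f x \<partial>M) else if r = q then (\<integral>x. g x \<partial>M) else 1)
        = (\<Prod>r<k. (if r = p then (\<integral>x. f x \<partial>M) else 1) * (if r = q then (\<integral>x. g x \<partial>M) else 1))"
        using False by (intro prod.cong) auto
      also have "\<dots> = (\<integral>x. f x \<partial>M) * (\<integral>x. g x \<partial>M)" using pq by (simp add: prod.distrib)
      finally show ?thesis using False by simp
    qed
    finally show "(\<integral>Y. f (Y p) * g (Y q) \<partial>?PM)
      = (if p = q then (\<integral>x. f x * g x \<partial>M) else (\<integral>x. f x \<partial>M) * (\<integral>x. g x \<partial>M))" .
  qed
  have "(\<integral>Y. (\<Sum>j<k. f (Y j)) * (\<Sum>j<k. g (Y j)) \<partial>?PM)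
      = (\<integral>Y. (\<Sum>p<k. \<Sum>q<k. f (Y p) * g (Y q)) \<partial>?PM)"
    by (simp add: sum_product)
  also have "\<dots> = (\<Sum>p<k. \<Sum>q<k. \<integral>Y. f (Y p) * g (Y q) \<partial>?PM)"
    by (subst Bochner_Integration.integral_sum; (intro Bochner_Integration.integrable_sum sum.cong refl int)?)
       (auto intro!: sum.cong Bochner_Integration.integral_sum int)
  also have "\<dots> = (\<Sum>p<k. \<Sum>q<k. (if p = q then (\<integral>x. f x * g x \<partial>M) - (\<integral>x. f x \<partial>M) * (\<integral>x. g x \<partial>M) else 0)
      + (\<integral>x. f x \<partial>M) * (\<integral>x. g x \<partial>M))"
    by (intro sum.cong refl) (auto simp: eq)
  also have "\<dots> = real k * ((\<integral>x. f x * g x \<partial>M) - (\<integral>x. f x \<partial>M) * (\<integral>x. g x \<partial>M))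
      + real k * (real k * ((\<integral>x. f x \<partial>M) * (\<integral>x. g x \<partial>M)))"
    by (simp add: sum.distrib distrib_left)
  finally show ?thesis by (simp add: algebra_simps)
qed

text \<open>The second-moment formula with g = 1 gives k times the claim, which is why k = 0 is set
  apart.\<close>

lemma (in prob_space) integral_PiM_sum:
  fixes f :: "'a \<Rightarrow> real"
  assumes f: "integrable M f"
  shows "(\<integral>Y. (\<Sum>j<k. f (Y j)) \<partial>(\<Pi>\<^sub>M j\<in>{..<k}. M)) = real k * (\<integral>x. f x \<partial>M)"
proof (cases "k = 0")
  case False
  then have "(\<Sum>j<k. (1::real)) = real k" by simp
  with integral_PiM_sum_mult_sum[OF f, of "\<lambda>_. 1" k] f False show ?thesis
    by (simp add: prob_space algebra_simps)
qed simp

lemma space_path_space [simp]: "space path_space = UNIV"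
  by (simp add: path_space_def space_PiM)

lemma measurable_coordinate [measurable]: "(\<lambda>x. x i) \<in> borel_measurable path_space"
  unfolding path_space_def by simp

text \<open>With W the sum of k independent copies of Z, E W i = k E Z i and Cov (W i, W j) = k (E Z
  i Z j - E Z i E Z j). Hence k (E Z i Z j + E Z i E Z j), which is k times the bound for a root,
  equals the covariance of W plus the 2 / k term.\<close>

lemma iid_sum_cmod_covariance_le:
  fixes \<mu> :: "(int \<Rightarrow> real) measure" and k :: nat and \<epsilon> d :: real and a :: "'i \<Rightarrow> real" and b :: "'j \<Rightarrow> real"
  defines "W \<equiv> \<lambda>i x. \<epsilon> * x i + d"
  assumes "prob_space \<mu>" and sets_\<mu>: "sets \<mu> = sets path_space" and k: "k \<ge> 1"
    and P: "P = distr (\<Pi>\<^sub>M j\<in>{..<k}. \<mu>) path_space (\<lambda>Y n. \<Sum>j<k. Y j n)"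
    and \<epsilon>: "\<epsilon> \<in> {-1, 1}"
    and nonneg: "\<And>i. AE x in P. W i x \<ge> 0"
    and sq: "\<And>i. integrable P (\<lambda>x. (x i)\<^sup>2)"
  shows "cmod ((\<integral>x. iexp ((\<Sum>i\<in>I. a i * x (p i)) + (\<Sum>j\<in>J. b j * x (q j))) \<partial>P)
      - (\<integral>x. iexp (\<Sum>i\<in>I. a i * x (p i)) \<partial>P) * (\<integral>x. iexp (\<Sum>j\<in>J. b j * x (q j)) \<partial>P))
    \<le> (\<Sum>i\<in>I. \<Sum>j\<in>J. \<bar>a i\<bar> * \<bar>b j\<bar> * ((\<integral>x. W (p i) x * W (q j) x \<partial>P)
        - (\<integral>x. W (p i) x \<partial>P) * (\<integral>x. W (q j) x \<partial>P)
        + 2 / real k * ((\<integral>x. W (p i) x \<partial>P) * (\<integral>x. W (q j) x \<partial>P))))"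
proof -
  interpret prob_space \<mu> by fact
  define PM where "PM = (\<Pi>\<^sub>M j\<in>{..<k}. \<mu>)"
  interpret PP: product_prob_space "\<lambda>_::nat. \<mu>" "{..<k}" by standard
  interpret PM: prob_space PM unfolding PM_def by (intro prob_space_PiM) (rule prob_space_axioms)
  define S :: "(nat \<Rightarrow> int \<Rightarrow> real) \<Rightarrow> int \<Rightarrow> real" where "S Y n = (\<Sum>j<k. Y j n)" for Y n
  have coord [measurable]: "(\<lambda>y. y i) \<in> borel_measurable \<mu>" for i
    by (subst measurable_cong_sets[OF sets_\<mu> refl]) (rule measurable_coordinate)
  have comp [measurable]: "(\<lambda>Y. Y j) \<in> PM \<rightarrow>\<^sub>M \<mu>" if "j < k" for j
    unfolding PM_def using that by simp
  have S_meas [measurable]: "S \<in> PM \<rightarrow>\<^sub>M path_space"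
  proof -
    have "(\<lambda>Y. Y j n) \<in> borel_measurable PM" if "j < k" for j n
      using measurable_compose[OF comp[OF that] coord[of n]] .
    then show ?thesis unfolding path_space_def S_def
      by (intro measurable_PiM_single') (auto intro!: borel_measurable_sum)
  qed
  have PS: "P = distr PM path_space S"
    by (simp add: P PM_def S_def[abs_def])
  \<comment> \<open>The translation is shared equally, so that the k copies of \<open>Z i\<close>
    add up to \<open>W i\<close>.\<close>
  define Z :: "int \<Rightarrow> (int \<Rightarrow> real) \<Rightarrow> real" where "Z i y = \<epsilon> * y i + d / real k" for i y
  have Z_meas [measurable]: "Z i \<in> borel_measurable \<mu>" for i
    unfolding Z_def by measurable
  have W_meas [measurable]: "W i \<in> borel_measurable path_space" for i
    unfolding W_def by measurable
  have WS: "W i (S Y) = (\<Sum>j<k. Z i (Y j))" for i Y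
    using k by (simp add: W_def S_def Z_def sum.distrib sum_distrib_left)
  have \<epsilon>2: "\<epsilon> * \<epsilon> = 1" using \<epsilon> by auto

  \<comment> \<open>If \<open>Z i\<close> were negative with positive probability, then by
    independence all k copies would be negative at once with positive probability, and so would
    their sum \<open>W i\<close>.\<close>
  have Z_nonneg: "AE y in \<mu>. Z i y \<ge> 0" for i
  proof -
    define A where "A = {y \<in> space \<mu>. Z i y < 0}"
    have A: "A \<in> sets \<mu>" unfolding A_def by measurable
    have pos: "AE Y in PM. W i (S Y) \<ge> 0"
    proof -
      have "{x \<in> space path_space. 0 \<le> W i x} \<in> sets path_space" by measurable
      from AE_distr_iff[OF S_meas this] nonneg[of i] show ?thesis unfolding PS by simp
    qed
    have neg: "W i (S Y) < 0" if "Y \<in> (\<Pi>\<^sub>E j\<in>{..<k}. A)" for Y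
      unfolding WS using sum_strict_mono[of "{..<k}" "\<lambda>j. Z i (Y j)" "\<lambda>_. 0"] that k
      by (auto simp: A_def PiE_iff lessThan_empty_iff)
    have null: "AE Y in PM. Y \<notin> (\<Pi>\<^sub>E j\<in>{..<k}. A)"
      using pos
    proof eventually_elim
      case (elim Y)
      then show ?case using neg[of Y] by (meson not_le)
    qed
    have AA: "(\<Pi>\<^sub>E j\<in>{..<k}. A) \<in> sets PM"
      unfolding PM_def using A by (intro sets_PiM_I_finite) auto
    have "emeasure PM (\<Pi>\<^sub>E j\<in>{..<k}. A) = 0"
      using AE_iff_null_sets[OF AA] null by auto
    moreover have "emeasure PM (\<Pi>\<^sub>E j\<in>{..<k}. A) = emeasure \<mu> A ^ k"
      unfolding PM_def using A by (subst PP.emeasure_PiM) auto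
    ultimately have "emeasure \<mu> A = 0" using k by simp
    then show ?thesis
      by (intro AE_I[of _ _ A]) (auto simp: A_def A[unfolded A_def] not_le)
  qed

  have "integrable P (\<lambda>x. (W i x)\<^sup>2)" for i
  proof -
    interpret P: prob_space P unfolding PS by (rule PM.prob_space_distr) simp
    have [measurable]: "(\<lambda>x. x i) \<in> borel_measurable P" by (simp add: PS)
    have "integrable P (\<lambda>x. x i)" by (rule P.square_integrable_imp_integrable[OF _ sq]) simp
    then have "integrable P (\<lambda>x. (x i)\<^sup>2 + 2 * \<epsilon> * d * x i + d\<^sup>2)" using sq[of i] by simp
    moreover have "(W i x)\<^sup>2 = (x i)\<^sup>2 + 2 * \<epsilon> * d * x i + d\<^sup>2" for x
      using \<epsilon> by (auto simp: W_def power2_eq_square algebra_simps)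
    ultimately show ?thesis by simp
  qed
  then have W2: "integrable PM (\<lambda>Y. (W i (S Y))\<^sup>2)" for i
    unfolding PS by (subst (asm) integrable_distr_eq) auto
  \<comment> \<open>Second moments pass to the roots because the summands are nonnegative: the copy
    with index 0 lies between 0 and the sum \<open>W i (S Y)\<close>.\<close>
  have Z2: "integrable \<mu> (\<lambda>y. (Z i y)\<^sup>2)" for i
  proof -
    have AE_Z: "AE Y in PM. \<forall>j<k. Z i (Y j) \<ge> 0"
      unfolding PM_def using AE_PiM_component[of "{..<k}" "\<lambda>_. \<mu>"] Z_nonneg prob_space_axioms
      by (auto simp: AE_ball_countable[of "{..<k}", simplified, unfolded Ball_def lessThan_iff])
    have [measurable]: "(\<lambda>Y. Z i (Y 0)) \<in> borel_measurable PM"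
      using measurable_compose[OF comp Z_meas] k by simp
    have "integrable PM (\<lambda>Y. (Z i (Y 0))\<^sup>2)"
    proof (rule Bochner_Integration.integrable_bound[OF W2[of i]])
      show "AE Y in PM. norm ((Z i (Y 0))\<^sup>2) \<le> norm ((W i (S Y))\<^sup>2)"
        using AE_Z
      proof eventually_elim
        case (elim Y)
        then have "Z i (Y 0) \<le> (\<Sum>j<k. Z i (Y j))" using k by (intro member_le_sum) auto
        then show ?case using elim k by (auto simp: WS intro!: power_mono)
      qed
    qed measurable
    moreover have "distr PM \<mu> (\<lambda>Y. Y 0) = \<mu>"
      unfolding PM_def using PP.PiM_component[of 0] k by simp
    ultimately show ?thesis
      using integrable_distr_eq[of "\<lambda>Y. Y 0" PM \<mu> "\<lambda>y. (Z i y)\<^sup>2"] comp[of 0] k by simp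
  qed
  have Z1: "integrable \<mu> (Z i)" for i
    using Z2[of i] by (rule square_integrable_imp_integrable[rotated]) simp
  have ZZ: "integrable \<mu> (\<lambda>y. Z i y * Z j y)" for i j
    by (intro integrable_mult_square_integrable Z2) measurable
  have EW: "(\<integral>x. W i x \<partial>P) = real k * (\<integral>y. Z i y \<partial>\<mu>)" for i
    unfolding PS by (subst integral_distr[OF S_meas]) (simp_all add: WS PM_def integral_PiM_sum[OF Z1])
  have EWW: "(\<integral>x. W i x * W j x \<partial>P) = real k * (\<integral>y. Z i y * Z j y \<partial>\<mu>)
      + (real k * real k - real k) * ((\<integral>y. Z i y \<partial>\<mu>) * (\<integral>y. Z j y \<partial>\<mu>))" for i j
    unfolding PS by (subst integral_distr[OF S_meas]) (simp_all add: WS PM_def integral_PiM_sum_mult_sum[OF Z1 Z1 ZZ])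

  define U V where "U y = (\<Sum>i\<in>I. a i * y (p i))" and "V y = (\<Sum>j\<in>J. b j * y (q j))" for y :: "int \<Rightarrow> real"
  have [measurable]: "U \<in> borel_measurable \<mu>" "V \<in> borel_measurable \<mu>"
    unfolding U_def V_def by measurable
  \<comment> \<open>\<open>F\<close> is additive over the summands, so independence turns its
    characteristic function into a k-th power.\<close>
  have char_power: "(\<integral>x. iexp (F x) \<partial>P) = (\<integral>y. iexp (F y) \<partial>\<mu>) ^ k"
    if F: "F \<in> borel_measurable path_space" and add: "\<And>Y. F (S Y) = (\<Sum>j<k. F (Y j))" for F
  proof -
    have Fm [measurable]: "F \<in> borel_measurable \<mu>"
      by (subst measurable_cong_sets[OF sets_\<mu> refl]) (rule F)
    have "(\<integral>x. iexp (F x) \<partial>P) = (\<integral>Y. (\<Prod>j<k. iexp (F (Y j))) \<partial>PM)"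
      unfolding PS using F by (subst integral_distr[OF S_meas]) (auto simp: add sum_distrib_left exp_sum)
    also have "\<dots> = (\<Prod>j<k. \<integral>y. iexp (F y) \<partial>\<mu>)"
      unfolding PM_def
      by (intro PP.product_integral_prod) (auto intro!: integrable_const_bound[of _ 1])
    finally show ?thesis by simp
  qed
  have addU: "U (S Y) = (\<Sum>j<k. U (Y j))" and addV: "V (S Y) = (\<Sum>j<k. V (Y j))" for Y
    unfolding U_def V_def S_def sum_distrib_left by (rule sum.swap)+
  have mU: "U \<in> borel_measurable path_space" and mV: "V \<in> borel_measurable path_space"
    unfolding U_def V_def by measurable
  have charU: "(\<integral>x. iexp (U x) \<partial>P) = (\<integral>y. iexp (U y) \<partial>\<mu>) ^ k"
    by (rule char_power[OF mU addU])
  have charV: "(\<integral>x. iexp (V x) \<partial>P) = (\<integral>y. iexp (V y) \<partial>\<mu>) ^ k"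
    by (rule char_power[OF mV addV])
  have charUV: "(\<integral>x. iexp (U x + V x) \<partial>P) = (\<integral>y. iexp (U y + V y) \<partial>\<mu>) ^ k"
    by (rule char_power) (use mU mV in \<open>auto simp: addU addV sum.distrib\<close>)

  define u' v' where "u' y = (\<Sum>i\<in>I. \<bar>a i\<bar> * Z (p i) y)" and "v' y = (\<Sum>j\<in>J. \<bar>b j\<bar> * Z (q j) y)" for y
  \<comment> \<open>Since \<epsilon> * \<epsilon> = 1, \<open>U\<close> and \<open>V\<close> are
    \<open>u\<close> and \<open>v\<close>, which are linear in the nonnegative \<open>Z\<close>,
    minus constants. The constants contribute a phase of modulus 1, so the estimate can be made for
    \<open>u\<close> and \<open>v\<close>.\<close>
  define u v where "u y = (\<Sum>i\<in>I. a i * \<epsilon> * Z (p i) y)" and "v y = (\<Sum>j\<in>J. b j * \<epsilon> * Z (q j) y)" for y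
  define cu cv where "cu = (\<Sum>i\<in>I. a i * \<epsilon> * d / real k)" and "cv = (\<Sum>j\<in>J. b j * \<epsilon> * d / real k)"
  have Uu: "U y = u y - cu" and Vv: "V y = v y - cv" for y
    using \<epsilon>2 unfolding U_def u_def cu_def V_def v_def cv_def Z_def sum_subtractf[symmetric]
    by (auto intro!: sum.cong simp: algebra_simps)
  have [measurable]: "u \<in> borel_measurable \<mu>" "v \<in> borel_measurable \<mu>"
    unfolding u_def v_def by measurable
  have Znn: "AE y in \<mu>. \<forall>i. Z i y \<ge> 0" using Z_nonneg by (simp add: AE_all_countable)
  have abs_\<epsilon>: "\<bar>\<epsilon>\<bar> = 1" using \<epsilon> by auto
  have u'v': "(\<lambda>y. u' y * v' y) = (\<lambda>y. \<Sum>i\<in>I. \<Sum>j\<in>J. \<bar>a i\<bar> * \<bar>b j\<bar> * (Z (p i) y * Z (q j) y))"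
    by (auto simp: u'_def v'_def sum_product mult_ac)
  define \<phi> where "\<phi> F = (\<integral>y. iexp (F y) \<partial>\<mu>)" for F
  have shift_phase: "\<phi> (\<lambda>y. F y - c) = \<phi> F * iexp (- c)" for F and c :: real
    by (simp add: \<phi>_def exp_diff divide_inverse exp_minus right_diff_distrib)
  have UV: "\<phi> (\<lambda>y. U y + V y) = \<phi> (\<lambda>y. u y + v y) * iexp (- (cu + cv))"
    by (subst shift_phase[symmetric]) (simp add: Uu Vv algebra_simps)
  have "\<phi> (\<lambda>y. U y + V y) - \<phi> U * \<phi> V = iexp (- (cu + cv)) * (\<phi> (\<lambda>y. u y + v y) - \<phi> u * \<phi> v)"
    unfolding UV using shift_phase[of u cu] shift_phase[of v cv]
    by (simp add: Uu[abs_def] Vv[abs_def] algebra_simps exp_add[symmetric])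
  then have "cmod (\<phi> (\<lambda>y. U y + V y) - \<phi> U * \<phi> V) = cmod (\<phi> (\<lambda>y. u y + v y) - \<phi> u * \<phi> v)"
    by (simp add: norm_mult)
  also have "\<dots> \<le> (\<integral>y. u' y * v' y \<partial>\<mu>) + (\<integral>y. u' y \<partial>\<mu>) * (\<integral>y. v' y \<partial>\<mu>)"
    unfolding \<phi>_def
  proof (rule cmod_covariance_iexp_le)
    show "integrable \<mu> u'" "integrable \<mu> v'" unfolding u'_def v'_def using Z1 by auto
    show "integrable \<mu> (\<lambda>y. u' y * v' y)" unfolding u'v' using ZZ by auto
    show "AE y in \<mu>. \<bar>u y\<bar> \<le> u' y" using Znn
      by eventually_elim (auto simp: u_def u'_def abs_mult abs_\<epsilon> intro!: order_trans[OF sum_abs] sum_mono)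
    show "AE y in \<mu>. \<bar>v y\<bar> \<le> v' y" using Znn
      by eventually_elim (auto simp: v_def v'_def abs_mult abs_\<epsilon> intro!: order_trans[OF sum_abs] sum_mono)
  qed measurable
  also have "\<dots> = (\<Sum>i\<in>I. \<Sum>j\<in>J. \<bar>a i\<bar> * \<bar>b j\<bar> * ((\<integral>y. Z (p i) y * Z (q j) y \<partial>\<mu>)
      + (\<integral>y. Z (p i) y \<partial>\<mu>) * (\<integral>y. Z (q j) y \<partial>\<mu>)))"
    unfolding u'v' unfolding u'_def v'_def using Z1 ZZ
    by (simp add: Bochner_Integration.integral_sum sum_product sum.distrib distrib_left mult_ac)
  finally have root: "cmod (\<phi> (\<lambda>y. U y + V y) - \<phi> U * \<phi> V) \<le> \<dots>" .
  have le1: "cmod (\<phi> F) \<le> 1" if "F \<in> borel_measurable \<mu>" for F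
    unfolding \<phi>_def using that by (intro order_trans[OF integral_norm_bound]) (simp add: prob_space)
  have "cmod (\<phi> (\<lambda>y. U y + V y) ^ k - (\<phi> U * \<phi> V) ^ k) \<le> real k * cmod (\<phi> (\<lambda>y. U y + V y) - \<phi> U * \<phi> V)"
    by (intro norm_power_diff) (auto simp: norm_mult intro!: le1 mult_le_one)
  also have "\<dots> \<le> real k * (\<Sum>i\<in>I. \<Sum>j\<in>J. \<bar>a i\<bar> * \<bar>b j\<bar> * ((\<integral>y. Z (p i) y * Z (q j) y \<partial>\<mu>)
      + (\<integral>y. Z (p i) y \<partial>\<mu>) * (\<integral>y. Z (q j) y \<partial>\<mu>)))"
    using root by (intro mult_left_mono) auto
  also have "\<dots> = (\<Sum>i\<in>I. \<Sum>j\<in>J. \<bar>a i\<bar> * \<bar>b j\<bar> * ((\<integral>x. W (p i) x * W (q j) x \<partial>P)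
        - (\<integral>x. W (p i) x \<partial>P) * (\<integral>x. W (q j) x \<partial>P)
        + 2 / real k * ((\<integral>x. W (p i) x \<partial>P) * (\<integral>x. W (q j) x \<partial>P))))"
    unfolding sum_distrib_left EW EWW using k
    by (intro sum.cong refl) (simp add: field_simps)
  finally show ?thesis
    unfolding \<phi>_def power_mult_distrib charU[symmetric] charV[symmetric] charUV[symmetric]
    by (simp add: U_def V_def)
qed

text \<open>The left-hand side does not depend on k, so the 2 / k term vanishes in the limit;
  passing from X to W leaves covariances unchanged because \<epsilon>^2 = 1. The index maps
  \<open>p\<close> and \<open>q\<close> let one factor be shifted in time without reindexing its
  coefficients.\<close>

lemma infinitely_divisible_cmod_covariance_le:
  fixes \<epsilon> d :: real and a :: "'i \<Rightarrow> real" and b :: "'j \<Rightarrow> real"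
  assumes "prob_space P" and sets_P: "sets P = sets path_space"
    and inf_div: "infinitely_divisible P"
    and \<epsilon>: "\<epsilon> \<in> {-1, 1}"
    and nonneg: "\<And>i. AE x in P. \<epsilon> * x i + d \<ge> 0"
    and sq: "\<And>i. integrable P (\<lambda>x. (x i)\<^sup>2)"
  shows "cmod ((\<integral>x. iexp ((\<Sum>i\<in>I. a i * x (p i)) + (\<Sum>j\<in>J. b j * x (q j))) \<partial>P)
      - (\<integral>x. iexp (\<Sum>i\<in>I. a i * x (p i)) \<partial>P) * (\<integral>x. iexp (\<Sum>j\<in>J. b j * x (q j)) \<partial>P))
    \<le> (\<Sum>i\<in>I. \<Sum>j\<in>J. \<bar>a i\<bar> * \<bar>b j\<bar>
        * ((\<integral>x. x (p i) * x (q j) \<partial>P) - (\<integral>x. x (p i) \<partial>P) * (\<integral>x. x (q j) \<partial>P)))"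
    (is "?lhs \<le> ?rhs")
proof -
  interpret prob_space P by fact
  have coord [measurable]: "(\<lambda>x. x i) \<in> borel_measurable P" for i
    by (subst measurable_cong_sets[OF sets_P refl]) (rule measurable_coordinate)
  have X1 [simp]: "integrable P (\<lambda>x. x i)" for i
    by (rule square_integrable_imp_integrable[OF coord sq])
  have X2 [simp]: "integrable P (\<lambda>x. x i * x j)" for i j
    by (intro integrable_mult_square_integrable sq coord)
  define W where "W i x = \<epsilon> * x i + d" for i and x :: "int \<Rightarrow> real"
  define D where "D i j = (\<integral>x. W i x \<partial>P) * (\<integral>x. W j x \<partial>P)" for i j
  have EW: "(\<integral>x. W i x \<partial>P) = \<epsilon> * (\<integral>x. x i \<partial>P) + d" for i
    by (simp add: W_def prob_space)
  have WW: "W i x * W j x = x i * x j + \<epsilon> * d * x i + \<epsilon> * d * x j + d * d" for i j x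
    using \<epsilon> by (auto simp: W_def algebra_simps)
  have cov: "(\<integral>x. W i x * W j x \<partial>P) - D i j
      = (\<integral>x. x i * x j \<partial>P) - (\<integral>x. x i \<partial>P) * (\<integral>x. x j \<partial>P)" for i j
    unfolding D_def EW WW using \<epsilon> by (auto simp: prob_space algebra_simps)
  have "?lhs \<le> (\<Sum>i\<in>I. \<Sum>j\<in>J. \<bar>a i\<bar> * \<bar>b j\<bar>
        * ((\<integral>x. x (p i) * x (q j) \<partial>P) - (\<integral>x. x (p i) \<partial>P) * (\<integral>x. x (q j) \<partial>P)
          + 2 / real k * D (p i) (q j)))" if "k \<ge> 1" for k
  proof -
    from inf_div \<open>k \<ge> 1\<close> obtain \<mu> where "prob_space \<mu>" "sets \<mu> = sets path_space"
      "P = distr (\<Pi>\<^sub>M j\<in>{..<k}. \<mu>) path_space (\<lambda>Y n. \<Sum>j<k. Y j n)"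
      unfolding infinitely_divisible_def by blast
    from iid_sum_cmod_covariance_le[OF this(1,2) that this(3) \<epsilon> nonneg sq,
        where I = I and J = J and a = a and p = p and b = b and q = q]
    show ?thesis
      unfolding W_def[symmetric] D_def[symmetric] cov .
  qed
  then have "\<exists>N. \<forall>k\<ge>N. ?lhs \<le> (\<Sum>i\<in>I. \<Sum>j\<in>J. \<bar>a i\<bar> * \<bar>b j\<bar>
        * ((\<integral>x. x (p i) * x (q j) \<partial>P) - (\<integral>x. x (p i) \<partial>P) * (\<integral>x. x (q j) \<partial>P)
          + 2 / real k * D (p i) (q j)))" by blast
  moreover have "(\<lambda>k. \<Sum>i\<in>I. \<Sum>j\<in>J. \<bar>a i\<bar> * \<bar>b j\<bar>
        * ((\<integral>x. x (p i) * x (q j) \<partial>P) - (\<integral>x. x (p i) \<partial>P) * (\<integral>x. x (q j) \<partial>P)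
          + 2 / real k * D (p i) (q j)))
      \<longlonglongrightarrow> (\<Sum>i\<in>I. \<Sum>j\<in>J. \<bar>a i\<bar> * \<bar>b j\<bar>
        * ((\<integral>x. x (p i) * x (q j) \<partial>P) - (\<integral>x. x (p i) \<partial>P) * (\<integral>x. x (q j) \<partial>P) + 0 * D (p i) (q j)))"
    by (intro tendsto_intros lim_const_over_n)
  ultimately show ?thesis by (auto intro: LIMSEQ_le_const)
qed

section \<open>Stationary laws\<close>

lemma measurable_shift [measurable]: "shift n \<in> path_space \<rightarrow>\<^sub>M path_space"
proof -
  have "(\<lambda>x k. x (k + n)) \<in> path_space \<rightarrow>\<^sub>M (\<Pi>\<^sub>M i\<in>UNIV. borel :: real measure)"
    by (rule measurable_PiM_single') auto
  then show ?thesis by (simp add: shift_def[abs_def] path_space_def)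
qed

lemma shift_shift [simp]: "shift m (shift n x) = shift (m + n) x"
  by (simp add: shift_def add.assoc)

lemma shift_0 [simp]: "shift 0 x = x"
  by (simp add: shift_def)

locale stationary_law = prob_space P for P :: "(int \<Rightarrow> real) measure" +
  assumes sets_P [measurable_cong]: "sets P = sets path_space"
    and shift_inv: "shift_invariant P"
begin

lemma space_P [simp]: "space P = UNIV"
  using sets_eq_imp_space_eq[OF sets_P] by simp

text \<open>Invariance is given for the shift by 1 and iterates to nonnegative n. For negative n, P
  is written as its own image under the shift by -n, which the shift by n then undoes.\<close>

lemma distr_shift: "distr P path_space (shift n) = P"
proof -
  have nat: "distr P path_space (shift (int m)) = P" for m
  proof (induction m)
    case 0
    show ?case by (simp add: shift_def distr_id2[OF sets_P[symmetric]])
  next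
    case (Suc m)
    have "distr P path_space (shift (int (Suc m)))
        = distr (distr P path_space (shift 1)) path_space (shift (int m))"
      by (subst distr_distr) (auto simp: o_def add.commute)
    then show ?case using Suc shift_inv by (simp add: shift_invariant_def)
  qed
  show ?thesis
  proof (cases "n \<ge> 0")
    case True
    then show ?thesis using nat[of "nat n"] by simp
  next
    case False
    have "distr P path_space (shift n)
        = distr (distr P path_space (shift (int (nat (- n))))) path_space (shift n)"
      by (simp only: nat)
    also have "\<dots> = distr P path_space (\<lambda>x. x)"
      by (subst distr_distr) (use False in \<open>auto simp: o_def\<close>)
    also have "\<dots> = P"
      by (rule distr_id2[OF sets_P[symmetric]])
    finally show ?thesis .
  qed
qed

lemma integral_shift:
  fixes f :: "(int \<Rightarrow> real) \<Rightarrow> 'b::{banach, second_countable_topology}"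
  assumes "f \<in> borel_measurable path_space"
  shows "(\<integral>x. f (shift n x) \<partial>P) = (\<integral>x. f x \<partial>P)"
proof -
  have "(\<integral>x. f x \<partial>P) = (\<integral>x. f x \<partial>distr P path_space (shift n))"
    by (simp only: distr_shift)
  then show ?thesis using assms by (simp add: integral_distr)
qed

lemma integrable_shift:
  fixes f :: "(int \<Rightarrow> real) \<Rightarrow> 'b::{banach, second_countable_topology}"
  assumes "integrable P f"
  shows "integrable P (\<lambda>x. f (shift n x))"
proof -
  have "integrable (distr P path_space (shift n)) f"
    using assms by (simp only: distr_shift)
  then show ?thesis by (subst (asm) integrable_distr_eq) (use assms in auto)
qed

text \<open>\<open>Q\<close> need not define a measurable set, so the argument runs through a
  measurable null set containing the exceptions.\<close>

lemma AE_shift: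
  assumes "AE x in P. Q x"
  shows "AE x in P. Q (shift n x)"
proof -
  obtain N where N: "{x. \<not> Q x} \<subseteq> N" "emeasure P N = 0" "N \<in> sets P"
    using assms by (rule AE_E) auto
  have "emeasure P (shift n -` N) = emeasure (distr P path_space (shift n)) N"
    using N(3) by (subst emeasure_distr) (auto simp: sets_P)
  then have "emeasure P (shift n -` N) = 0" using N(2) by (simp only: distr_shift)
  moreover have "shift n -` N \<in> sets P"
    using measurable_sets[OF measurable_shift[of n], of N] N(3) by (simp add: sets_P)
  ultimately show ?thesis
    by (intro AE_I[of _ _ "shift n -` N"]) (use N(1) in auto)
qed

end

section \<open>Approximation by trigonometric polynomials\<close>

text \<open>The inductive form reduces bilinear statements about correlations to single exponentials
  by rule induction.\<close>

inductive trig_poly :: "((int \<Rightarrow> real) \<Rightarrow> complex) \<Rightarrow> bool" where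
  iexp: "finite I \<Longrightarrow> trig_poly (\<lambda>x. iexp (\<Sum>i\<in>I. a i * x i))"
| add: "trig_poly p \<Longrightarrow> trig_poly q \<Longrightarrow> trig_poly (\<lambda>x. p x + q x)"
| scale: "trig_poly p \<Longrightarrow> trig_poly (\<lambda>x. c * p x)"

lemma trig_poly_const: "trig_poly (\<lambda>_. c)"
  using trig_poly.scale[OF trig_poly.iexp[of "{}" "\<lambda>_. 0"], of c] by simp

lemma trig_poly_iexp_coordinate: "trig_poly (\<lambda>x. iexp (s * x i))"
  using trig_poly.iexp[of "{i}" "\<lambda>_. s"] by simp

text \<open>Two exponentials multiply to one whose coefficients, extended by 0 to I \<union> J, are
  added. Approximability is stable under products for this reason, as the step polynomials and
  intersections of sets require.\<close>

lemma trig_poly_mult: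
  assumes "trig_poly p" "trig_poly q"
  shows "trig_poly (\<lambda>x. p x * q x)"
  using assms
proof (induction p)
  case (iexp I a)
  from \<open>trig_poly q\<close> show ?case
  proof (induction q)
    case (iexp J b)
    have ext: "(\<Sum>i\<in>A. c i * x i) = (\<Sum>i\<in>I \<union> J. (if i \<in> A then c i else 0) * x i)"
      if "A \<subseteq> I \<union> J" for A and c x :: "int \<Rightarrow> real"
      using \<open>finite I\<close> \<open>finite J\<close> that by (intro sum.mono_neutral_cong_left) auto
    let ?c = "\<lambda>i. (if i \<in> I then a i else 0) + (if i \<in> J then b i else 0)"
    have "(\<Sum>i\<in>I \<union> J. ?c i * x i) = (\<Sum>i\<in>I. a i * x i) + (\<Sum>i\<in>J. b i * x i)" for x
      by (simp only: ext[of I a x] ext[of J b x] Un_upper1 Un_upper2 sum.distrib[symmetric] distrib_right)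
    then have "iexp (\<Sum>i\<in>I. a i * x i) * iexp (\<Sum>i\<in>J. b i * x i) = iexp (\<Sum>i\<in>I \<union> J. ?c i * x i)" for x
      by (simp only: exp_add of_real_add distrib_left)
    then show ?case
      using trig_poly.iexp[of "I \<union> J" ?c] \<open>finite I\<close> \<open>finite J\<close> by (simp only: finite_Un)
  next
    case (add q r)
    then show ?case using trig_poly.add[OF add.IH] by (simp add: distrib_left)
  next
    case (scale q c)
    then show ?case using trig_poly.scale[OF scale.IH, of c] by (simp add: mult.left_commute)
  qed
next
  case (add p r)
  then show ?case using trig_poly.add[OF add.IH] by (simp add: distrib_right)
next
  case (scale p c)
  then show ?case using trig_poly.scale[OF scale.IH, of c] by (simp add: mult.assoc)
qed

text \<open>The bound holds everywhere rather than almost everywhere, so the closure properties can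
  be stated before any law is fixed.\<close>

definition bounded_measurable :: "((int \<Rightarrow> real) \<Rightarrow> complex) \<Rightarrow> bool" where
  "bounded_measurable f \<longleftrightarrow> f \<in> borel_measurable path_space \<and> (\<exists>C. \<forall>x. cmod (f x) \<le> C)"

lemma bounded_measurableI:
  "f \<in> borel_measurable path_space \<Longrightarrow> (\<And>x. cmod (f x) \<le> C) \<Longrightarrow> bounded_measurable f"
  unfolding bounded_measurable_def by blast

lemma bounded_measurableE:
  assumes "bounded_measurable f"
  obtains C where "C > 0" "\<And>x. cmod (f x) \<le> C" "f \<in> borel_measurable path_space"
proof -
  from assms obtain C where "\<forall>x. cmod (f x) \<le> C" "f \<in> borel_measurable path_space"
    unfolding bounded_measurable_def by blast
  then show ?thesis by (intro that[of "max C 1"]) (auto simp: le_max_iff_disj)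
qed

lemma bounded_measurable_add:
  assumes "bounded_measurable f" "bounded_measurable g"
  shows "bounded_measurable (\<lambda>x. f x + g x)"
proof -
  obtain C D where [measurable]: "f \<in> borel_measurable path_space" "g \<in> borel_measurable path_space"
    and "\<And>x. cmod (f x) \<le> C" "\<And>x. cmod (g x) \<le> D"
    using assms by (metis bounded_measurableE)
  then show ?thesis
    by (intro bounded_measurableI[of _ "C + D"]) (measurable, auto intro: norm_triangle_mono)
qed

lemma bounded_measurable_mult:
  assumes "bounded_measurable f" "bounded_measurable g"
  shows "bounded_measurable (\<lambda>x. f x * g x)"
proof -
  obtain C D where [measurable]: "f \<in> borel_measurable path_space" "g \<in> borel_measurable path_space"
    and C: "\<And>x. cmod (f x) \<le> C" "\<And>x. cmod (g x) \<le> D" "C > 0" "D > 0"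
    using assms by (metis bounded_measurableE)
  show ?thesis
  proof (rule bounded_measurableI)
    show "cmod (f x * g x) \<le> C * D" for x
      unfolding norm_mult using C by (intro mult_mono) auto
  qed measurable
qed

lemma bounded_measurable_const [simp]: "bounded_measurable (\<lambda>_. c)"
  by (rule bounded_measurableI[of _ "cmod c"]) auto

lemma bounded_measurable_scale: "bounded_measurable f \<Longrightarrow> bounded_measurable (\<lambda>x. c * f x)"
  by (intro bounded_measurable_mult) auto

lemma bounded_measurable_diff:
  "bounded_measurable f \<Longrightarrow> bounded_measurable g \<Longrightarrow> bounded_measurable (\<lambda>x. f x - g x)"
  using bounded_measurable_add[of f "\<lambda>x. - 1 * g x"] bounded_measurable_scale[of g "-1"] by simp

lemma bounded_measurable_shift: "bounded_measurable f \<Longrightarrow> bounded_measurable (\<lambda>x. f (shift n x))"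
  unfolding bounded_measurable_def using measurable_compose[OF measurable_shift] by blast

lemma bounded_measurable_iexp:
  "f \<in> borel_measurable path_space \<Longrightarrow> bounded_measurable (\<lambda>x. iexp (f x))"
  by (rule bounded_measurableI[of _ 1]) auto

lemma bounded_measurable_indicator: "A \<in> sets path_space \<Longrightarrow> bounded_measurable (indicator A)"
  by (rule bounded_measurableI[of _ 1]) (auto simp: indicator_def)

lemma trig_poly_bounded_measurable: "trig_poly p \<Longrightarrow> bounded_measurable p"
proof (induction p rule: trig_poly.induct)
  case (iexp I a)
  show ?case by (rule bounded_measurable_iexp) measurable
qed (auto intro: bounded_measurable_add bounded_measurable_scale)

section \<open>Functions approximable in L^1 by trigonometric polynomials\<close>

context stationary_law
begin

lemma integrable_bounded_measurable:
  assumes "bounded_measurable f" shows "integrable P f"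
  using assms by (elim bounded_measurableE) (rule integrable_const_bound, auto)

lemma integrable_cmod_diff:
  "bounded_measurable f \<Longrightarrow> bounded_measurable g \<Longrightarrow> integrable P (\<lambda>x. cmod (f x - g x))"
  by (intro integrable_norm integrable_bounded_measurable bounded_measurable_diff)

text \<open>Boundedness is part of the notion because L^1 limits alone are not stable under
  products.\<close>

definition trig_approximable :: "((int \<Rightarrow> real) \<Rightarrow> complex) \<Rightarrow> bool" where
  "trig_approximable f \<longleftrightarrow>
     bounded_measurable f \<and> (\<forall>e>0. \<exists>p. trig_poly p \<and> (\<integral>x. cmod (f x - p x) \<partial>P) < e)"

lemma trig_approximableD:
  assumes "trig_approximable f" "e > 0"
  obtains p where "trig_poly p" "bounded_measurable p" "(\<integral>x. cmod (f x - p x) \<partial>P) < e"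
  using assms trig_poly_bounded_measurable unfolding trig_approximable_def by blast

lemma trig_approximable_bounded_measurable: "trig_approximable f \<Longrightarrow> bounded_measurable f"
  by (simp add: trig_approximable_def)

lemma trig_approximable_trig_poly: "trig_poly p \<Longrightarrow> trig_approximable p"
  unfolding trig_approximable_def using trig_poly_bounded_measurable by auto

lemma trig_approximable_add:
  assumes f: "trig_approximable f" and g: "trig_approximable g"
  shows "trig_approximable (\<lambda>x. f x + g x)"
  unfolding trig_approximable_def
proof (intro conjI allI impI)
  note bf = trig_approximable_bounded_measurable[OF f] and bg = trig_approximable_bounded_measurable[OF g]
  show "bounded_measurable (\<lambda>x. f x + g x)" by (intro bounded_measurable_add bf bg)
  fix e :: real assume "e > 0"
  obtain p where p: "trig_poly p" "bounded_measurable p" "(\<integral>x. cmod (f x - p x) \<partial>P) < e / 2"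
    using trig_approximableD[OF f, of "e / 2"] \<open>e > 0\<close> by auto
  obtain q where q: "trig_poly q" "bounded_measurable q" "(\<integral>x. cmod (g x - q x) \<partial>P) < e / 2"
    using trig_approximableD[OF g, of "e / 2"] \<open>e > 0\<close> by auto
  have "(\<integral>x. cmod (f x + g x - (p x + q x)) \<partial>P) \<le> (\<integral>x. cmod (f x - p x) + cmod (g x - q x) \<partial>P)"
    by (intro integral_mono integrable_cmod_diff Bochner_Integration.integrable_add
        bounded_measurable_add bf bg p q) (metis add_diff_add norm_triangle_ineq)
  also have "\<dots> < e"
    using p q by (subst Bochner_Integration.integral_add) (auto intro: integrable_cmod_diff bf bg)
  finally show "\<exists>p. trig_poly p \<and> (\<integral>x. cmod (f x + g x - p x) \<partial>P) < e"
    using trig_poly.add[OF p(1) q(1)] by blast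
qed

text \<open>The approximant of \<open>g\<close> is chosen first: the precision required for \<open>f\<close> depends on its
  sup norm.\<close>

lemma trig_approximable_mult:
  assumes f: "trig_approximable f" and g: "trig_approximable g"
  shows "trig_approximable (\<lambda>x. f x * g x)"
  unfolding trig_approximable_def
proof (intro conjI allI impI)
  note bf = trig_approximable_bounded_measurable[OF f] and bg = trig_approximable_bounded_measurable[OF g]
  show "bounded_measurable (\<lambda>x. f x * g x)" by (intro bounded_measurable_mult bf bg)
  fix e :: real assume "e > 0"
  obtain F where F: "F > 0" "\<And>x. cmod (f x) \<le> F" by (rule bounded_measurableE[OF bf]) blast
  obtain q where q: "trig_poly q" "bounded_measurable q" "(\<integral>x. cmod (g x - q x) \<partial>P) < e / (2 * F)"
    using trig_approximableD[OF g, of "e / (2 * F)"] \<open>e > 0\<close> F by auto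
  obtain G where G: "G > 0" "\<And>x. cmod (q x) \<le> G" by (rule bounded_measurableE[OF q(2)]) blast
  obtain p where p: "trig_poly p" "bounded_measurable p" "(\<integral>x. cmod (f x - p x) \<partial>P) < e / (2 * G)"
    using trig_approximableD[OF f, of "e / (2 * G)"] \<open>e > 0\<close> G by auto
  have int: "integrable P (\<lambda>x. G * cmod (f x - p x))" "integrable P (\<lambda>x. F * cmod (g x - q x))"
    by (intro integrable_mult_right integrable_cmod_diff bf bg p q)+
  have "(\<integral>x. cmod (f x * g x - p x * q x) \<partial>P) \<le> (\<integral>x. G * cmod (f x - p x) + F * cmod (g x - q x) \<partial>P)"
  proof (intro integral_mono integrable_cmod_diff Bochner_Integration.integrable_add int
        bounded_measurable_mult bf bg p q)
    fix x
    have "cmod (f x * g x - p x * q x) = cmod ((f x - p x) * q x + f x * (g x - q x))"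
      by (simp add: algebra_simps)
    also have "\<dots> \<le> cmod (f x - p x) * cmod (q x) + cmod (f x) * cmod (g x - q x)"
      by (rule order_trans[OF norm_triangle_ineq]) (simp add: norm_mult)
    also have "\<dots> \<le> cmod (f x - p x) * G + F * cmod (g x - q x)"
      by (intro add_mono mult_left_mono mult_right_mono F G) auto
    finally show "cmod (f x * g x - p x * q x) \<le> G * cmod (f x - p x) + F * cmod (g x - q x)"
      by (simp add: mult.commute)
  qed
  also have "\<dots> = G * (\<integral>x. cmod (f x - p x) \<partial>P) + F * (\<integral>x. cmod (g x - q x) \<partial>P)"
    using int by simp
  also have "\<dots> < e"
    using p(3) q(3) F G by (simp add: field_simps)
  finally show "\<exists>p. trig_poly p \<and> (\<integral>x. cmod (f x * g x - p x) \<partial>P) < e"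
    using trig_poly_mult[OF p(1) q(1)] by blast
qed

lemma trig_approximable_const: "trig_approximable (\<lambda>_. c)"
  by (intro trig_approximable_trig_poly trig_poly_const)

lemma trig_approximable_diff:
  assumes f: "trig_approximable f" and g: "trig_approximable g"
  shows "trig_approximable (\<lambda>x. f x - g x)"
  using trig_approximable_add[OF f trig_approximable_mult[OF trig_approximable_const[of "-1"] g]] by simp

lemma trig_approximable_power: "trig_approximable f \<Longrightarrow> trig_approximable (\<lambda>x. f x ^ n)"
  by (induction n) (auto intro: trig_approximable_const trig_approximable_mult)

text \<open>Bounded pointwise convergence implies L^1 convergence, by dominated convergence with the
  constant 2 C. Discontinuous limits such as steps and indicators come within reach in this
  way.\<close>

lemma trig_approximable_lim:
  assumes F: "\<And>n. trig_approximable (F n)"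
    and lim: "\<And>x. (\<lambda>n. F n x) \<longlonglongrightarrow> f x" and bound: "\<And>n x. cmod (F n x) \<le> C"
  shows "trig_approximable f"
  unfolding trig_approximable_def
proof (intro conjI allI impI)
  note bF = trig_approximable_bounded_measurable[OF F]
  have [measurable]: "F n \<in> borel_measurable path_space" for n
    using bF by (simp add: bounded_measurable_def)
  have [measurable]: "f \<in> borel_measurable path_space"
    by (rule borel_measurable_LIMSEQ_metric[OF _ lim]) measurable
  have fC: "cmod (f x) \<le> C" for x
    by (rule Lim_bounded[OF tendsto_norm[OF lim]]) (use bound in auto)
  show bf: "bounded_measurable f" by (rule bounded_measurableI[OF _ fC]) measurable
  fix e :: real assume "e > 0"
  have "(\<lambda>n. \<integral>x. cmod (f x - F n x) \<partial>P) \<longlonglongrightarrow> (\<integral>x. 0 \<partial>P)"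
  proof (rule integral_dominated_convergence[where w = "\<lambda>_. 2 * C"])
    have "(\<lambda>n. cmod (f x - F n x)) \<longlonglongrightarrow> cmod (f x - f x)" for x
      by (intro tendsto_intros lim)
    then show "AE x in P. (\<lambda>n. cmod (f x - F n x)) \<longlonglongrightarrow> 0" by simp
    show "AE x in P. norm (cmod (f x - F n x)) \<le> 2 * C" for n
      by (auto intro!: AE_I2 order_trans[OF norm_triangle_ineq4] add_mono[OF fC bound, THEN order_trans])
  qed auto
  then have "\<forall>\<^sub>F n in sequentially. (\<integral>x. cmod (f x - F n x) \<partial>P) < e / 2"
    using \<open>e > 0\<close> by (intro order_tendstoD) auto
  then obtain n where n: "(\<integral>x. cmod (f x - F n x) \<partial>P) < e / 2"
    by (auto dest: eventually_happens)
  obtain p where p: "trig_poly p" "bounded_measurable p" "(\<integral>x. cmod (F n x - p x) \<partial>P) < e / 2"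
    using trig_approximableD[OF F, of "e / 2"] \<open>e > 0\<close> by auto
  have "(\<integral>x. cmod (f x - p x) \<partial>P) \<le> (\<integral>x. cmod (f x - F n x) + cmod (F n x - p x) \<partial>P)"
    by (intro integral_mono integrable_cmod_diff Bochner_Integration.integrable_add bf bF p)
      (metis diff_add_cancel add_diff_eq norm_triangle_ineq)
  also have "\<dots> < e"
    using n p by (subst Bochner_Integration.integral_add) (auto intro: integrable_cmod_diff bf bF)
  finally show "\<exists>p. trig_poly p \<and> (\<integral>x. cmod (f x - p x) \<partial>P) < e" using p by blast
qed

end

text \<open>\<open>1 - (1 - u^n)^(2^n)\<close> is a polynomial approximation of a unit step at \<open>1 / 2\<close>.\<close>

lemma step_tendsto:
  fixes u :: real
  assumes "0 \<le> u" "u \<le> 1"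
  shows "(\<lambda>n. 1 - (1 - u ^ n) ^ (2 ^ n)) \<longlonglongrightarrow> (if u < 1/2 then 0 else if u = 1/2 then 1 - exp (-1) else 1)"
proof -
  consider "u < 1/2" | "u = 1/2" | "u > 1/2" by linarith
  then show ?thesis
  proof cases
    case 1
    \<comment> \<open>Bernoulli's inequality (1 - x)^m \<ge> 1 - m x with x = u^n and m = 2^n, where
      m x = (2 u)^n.\<close>
    have up: "1 - (1 - u ^ n) ^ (2 ^ n) \<le> (2 * u) ^ n" for n
      using Bernoulli_inequality[of "- (u ^ n)" "2 ^ n"] assms
      by (simp add: power_le_one power_mult_distrib)
    have lo: "0 \<le> 1 - (1 - u ^ n) ^ (2 ^ n)" for n
      using assms by (simp add: power_le_one)
    have "(\<lambda>n. (2 * u) ^ n) \<longlonglongrightarrow> 0"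
      using 1 assms by (intro LIMSEQ_realpow_zero) auto
    then have "(\<lambda>n. 1 - (1 - u ^ n) ^ (2 ^ n)) \<longlonglongrightarrow> 0"
      by (rule real_tendsto_sandwich[OF _ _ tendsto_const, rotated 2]) (use up lo in auto)
    then show ?thesis using 1 by simp
  next
    case 2
    \<comment> \<open>At the jump u^n = 1 / 2^n, so the limit of (1 - 1 / m)^m along m = 2^n
      explains the value 1 - exp (-1).\<close>
    have "(\<lambda>n. (1 + (-1) / real (2 ^ n)) ^ (2 ^ n)) \<longlonglongrightarrow> exp (-1)"
      using LIMSEQ_subseq_LIMSEQ[OF tendsto_exp_limit_sequentially[of "-1"], of "\<lambda>n. 2 ^ n"]
      by (simp add: o_def strict_mono_def)
    then have "(\<lambda>n. 1 - (1 + (-1) / real (2 ^ n)) ^ (2 ^ n)) \<longlonglongrightarrow> 1 - exp (-1)"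
      by (intro tendsto_intros)
    then show ?thesis unfolding 2 by (simp add: power_one_over)
  next
    case 3
    \<comment> \<open>From 1 - x \<le> exp (- x); the exponent 2^n u^n = (2 u)^n now
      diverges.\<close>
    have up: "(1 - u ^ n) ^ (2 ^ n) \<le> exp (- ((2 * u) ^ n))" for n
    proof -
      have "(1 - u ^ n) ^ (2 ^ n) \<le> exp (- (u ^ n)) ^ (2 ^ n)"
        using exp_ge_add_one_self[of "- (u ^ n)"] assms by (intro power_mono) (auto simp: power_le_one)
      then show ?thesis by (simp add: exp_of_nat_mult[symmetric] power_mult_distrib)
    qed
    have lo: "0 \<le> (1 - u ^ n) ^ (2 ^ n)" for n
      using assms by (simp add: power_le_one)
    have "filterlim (\<lambda>n. (2 * u) ^ n) at_top sequentially"
      using 3 by (intro filterlim_at_infinity_imp_filterlim_at_top filterlim_realpow_sequentially_gt1) auto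
    then have "(\<lambda>n. exp (- ((2 * u) ^ n))) \<longlonglongrightarrow> 0"
      by (intro filterlim_compose[OF exp_at_bot] filterlim_compose[OF filterlim_uminus_at_bot_at_top])
    then have "(\<lambda>n. (1 - u ^ n) ^ (2 ^ n)) \<longlonglongrightarrow> 0"
      by (rule real_tendsto_sandwich[OF _ _ tendsto_const, rotated 2]) (use up lo in auto)
    then have "(\<lambda>n. 1 - (1 - u ^ n) ^ (2 ^ n)) \<longlonglongrightarrow> 1 - 0"
      by (intro tendsto_intros)
    then show ?thesis using 3 by simp
  qed
qed

lemma step_bounds:
  fixes u :: real
  assumes "0 \<le> u" "u \<le> 1"
  shows "\<bar>1 - (1 - u ^ n) ^ m\<bar> \<le> 1"
proof -
  have "u ^ n \<le> 1" "0 \<le> u ^ n" using assms by (auto intro: power_le_one)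
  then have "0 \<le> (1 - u ^ n) ^ m" "(1 - u ^ n) ^ m \<le> 1"
    by (auto intro: power_le_one)
  then show ?thesis by linarith
qed

section \<open>From step polynomials to indicators of measurable sets\<close>

context stationary_law
begin

text \<open>A coordinate is unbounded and cannot be put into the step polynomials. Its sine at scale
  m > 0 is a trigonometric polynomial with values in [-1, 1], and it has the sign of x i - t as soon
  as |x i - t| < pi m.\<close>

lemma trig_approximable_sin: "trig_approximable (\<lambda>x. of_real (sin ((x i - t) / m)))"
proof -
  have "trig_approximable (\<lambda>x. 1 / (2 * \<i>) * (iexp (- t / m) * iexp (1 / m * x i)
      - iexp (t / m) * iexp (- (1 / m) * x i)))"
    by (intro trig_approximable_mult trig_approximable_diff trig_approximable_const
        trig_approximable_trig_poly trig_poly_iexp_coordinate)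
  moreover have "1 / (2 * \<i>) * (iexp (- t / m) * iexp (1 / m * x i) - iexp (t / m) * iexp (- (1 / m) * x i))
      = of_real (sin ((x i - t) / m))" for x :: "int \<Rightarrow> real"
  proof -
    have "iexp (- t / m) * iexp (1 / m * x i) = iexp ((x i - t) / m)"
      "iexp (t / m) * iexp (- (1 / m) * x i) = iexp (- ((x i - t) / m))"
      unfolding exp_add[symmetric] distrib_left[symmetric] of_real_add[symmetric]
      by (simp_all add: diff_divide_distrib)
    then show ?thesis
      by (simp only: sin_of_real[symmetric] sin_exp_eq) simp
  qed
  ultimately show ?thesis by simp
qed

text \<open>The limit of the step polynomials, recentred to jump at 0. The value at 0 is the one
  that this limit produces; it disappears once thresholds are approached from above.\<close>

definition half_step :: "real \<Rightarrow> real" where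
  "half_step y = (if y < 0 then 0 else if y = 0 then 1 - exp (-1) else 1)"

text \<open>The map y -> (1 + y) / 2 sends [-1, 1] to [0, 1], where the step polynomials are bounded
  by 1, and sends 0 to their jump at 1 / 2.\<close>

lemma trig_approximable_half_step_compose:
  assumes g: "trig_approximable (\<lambda>x. of_real (g x))" and bounds: "\<And>x. -1 \<le> g x" "\<And>x. g x \<le> 1"
  shows "trig_approximable (\<lambda>x. of_real (half_step (g x)))"
proof (rule trig_approximable_lim)
  define u where "u x = (1 + g x) / 2" for x
  define F where "F n x = 1 - (1 - u x ^ n) ^ (2 ^ n)" for n x
  have u: "0 \<le> u x" "u x \<le> 1" for x
    using bounds[of x] by (simp_all add: u_def)
  show "trig_approximable (\<lambda>x. of_real (F n x))" for n
  proof -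
    have "trig_approximable (\<lambda>x. 1 - (1 - (1 / 2 * (1 + of_real (g x))) ^ n) ^ (2 ^ n))"
      by (intro trig_approximable_mult trig_approximable_diff trig_approximable_const
          trig_approximable_power trig_approximable_add g)
    then show ?thesis by (simp add: F_def u_def)
  qed
  show "(\<lambda>n. of_real (F n x)) \<longlonglongrightarrow> complex_of_real (half_step (g x))" for x
  proof -
    have "half_step (g x) = (if u x < 1/2 then 0 else if u x = 1/2 then 1 - exp (-1) else 1)"
      by (auto simp: half_step_def u_def)
    then show ?thesis using step_tendsto[OF u, of x] by (intro tendsto_of_real) (simp only: F_def)
  qed
  show "cmod (of_real (F n x)) \<le> 1" for n x
    using step_bounds[OF u] by (simp only: F_def norm_of_real)
qed

lemma trig_approximable_half_step_sin:
  "trig_approximable (\<lambda>x. of_real (half_step (sin ((x i - t) / m))))"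
  by (intro trig_approximable_half_step_compose trig_approximable_sin) auto

lemma trig_approximable_half_step: "trig_approximable (\<lambda>x. of_real (half_step (x i - t)))"
proof (rule trig_approximable_lim[OF trig_approximable_half_step_sin])
  fix x :: "int \<Rightarrow> real"
  define y where "y = x i - t"
  obtain N :: nat where N: "\<bar>y\<bar> < real N" using reals_Archimedean2 by blast
  \<comment> \<open>For m > |y| the argument lies in ]-1, 1[, hence in ]-pi, pi[, where the sine has
    the sign of its argument.\<close>
  have "half_step (sin (y / real m)) = half_step y" if "m \<ge> N" for m
  proof -
    have m: "\<bar>y\<bar> < real m" using N that by linarith
    then have "\<bar>y / real m\<bar> < 1" by simp
    then have "\<bar>y / real m\<bar> < pi" using pi_gt3 by linarith
    then show ?thesis
      using sin_gt_zero[of "y / real m"] sin_gt_zero[of "- (y / real m)"] m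
      by (cases "y = 0"; cases "y > 0") (auto simp: half_step_def divide_neg_pos)
  qed
  then have "\<forall>\<^sub>F m in sequentially. half_step (sin (y / real m)) = half_step y"
    by (auto simp: eventually_sequentially)
  then show "(\<lambda>m. complex_of_real (half_step (sin ((x i - t) / real m)))) \<longlonglongrightarrow> of_real (half_step (x i - t))"
    unfolding y_def[symmetric] by (intro tendsto_of_real tendsto_eventually)
  show "cmod (of_real (half_step (sin ((x i - t) / real m)))) \<le> 1" for m x
    by (auto simp: half_step_def)
qed

text \<open>The thresholds t + 1 / (n + 1) lie strictly above t: for x i \<le> t every term is 0,
  and for x i > t the terms are eventually 1. The intermediate value of \<open>half_step\<close>
  does not survive.\<close>

lemma trig_approximable_indicator_greater: "trig_approximable (indicator {x. t < x i})"
proof (rule trig_approximable_lim[OF trig_approximable_half_step])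
  fix x :: "int \<Rightarrow> real"
  have "\<forall>\<^sub>F n in sequentially. half_step (x i - (t + 1 / Suc n)) = indicator {x. t < x i} x"
  proof (cases "t < x i")
    case True
    obtain N where N: "1 / Suc N < x i - t"
      using reals_Archimedean[of "x i - t"] True by (auto simp: inverse_eq_divide)
    have "half_step (x i - (t + 1 / Suc n)) = 1" if "n \<ge> N" for n
    proof -
      have "1 / real (Suc n) \<le> 1 / real (Suc N)" using that by (simp add: frac_le)
      with N have "x i - (t + 1 / Suc n) > 0" by linarith
      then show ?thesis unfolding half_step_def by simp
    qed
    then show ?thesis using True unfolding eventually_sequentially by auto
  next
    case False
    have "half_step (x i - (t + 1 / Suc n)) = 0" for n
    proof -
      have "0 < 1 / real (Suc n)" by simp
      with False have "x i - (t + 1 / Suc n) < 0" by linarith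
      then show ?thesis unfolding half_step_def by simp
    qed
    then show ?thesis using False by simp
  qed
  then have "(\<lambda>n. complex_of_real (half_step (x i - (t + 1 / Suc n))))
      \<longlonglongrightarrow> of_real (indicator {x. t < x i} x)"
    by (intro tendsto_of_real tendsto_eventually)
  then show "(\<lambda>n. complex_of_real (half_step (x i - (t + 1 / Suc n)))) \<longlonglongrightarrow> indicator {x. t < x i} x"
    by (cases "t < x i") simp_all
  show "cmod (of_real (half_step (x i - (t + 1 / Suc n)))) \<le> 1" for n x
    by (auto simp: half_step_def)
qed

text \<open>The sets with approximable indicator form a \<sigma>-algebra: products give
  intersections, differences from 1 give complements, bounded limits give countable unions. It makes
  every coordinate measurable, hence contains the product \<sigma>-algebra.\<close>

lemma trig_approximable_indicator:
  assumes "A \<in> sets path_space"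
  shows "trig_approximable (indicator A)"
proof -
  define D where "D = {A. trig_approximable (indicator A)}"
  have compl: "UNIV - A \<in> D" if "A \<in> D" for A
  proof -
    have "indicator (UNIV - A) = (\<lambda>x. 1 - indicator A x :: complex)" by (auto simp: indicator_def)
    then show ?thesis using that by (auto simp: D_def intro: trig_approximable_diff trig_approximable_const)
  qed
  have inter: "A \<inter> B \<in> D" if "A \<in> D" "B \<in> D" for A B
  proof -
    have "indicator (A \<inter> B) = (\<lambda>x. indicator A x * indicator B x :: complex)" by (auto simp: indicator_def)
    then show ?thesis using that by (auto simp: D_def intro: trig_approximable_mult)
  qed
  have un: "A \<union> B \<in> D" if "A \<in> D" "B \<in> D" for A B
  proof -
    have "A \<union> B = UNIV - ((UNIV - A) \<inter> (UNIV - B))" by auto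
    then show ?thesis using compl inter that by metis
  qed
  have "{} \<in> D" unfolding D_def using trig_approximable_const[of 0] by (simp add: indicator_def[abs_def])
  have "(\<Union>n. A n) \<in> D" if "range A \<subseteq> D" for A :: "nat \<Rightarrow> (int \<Rightarrow> real) set"
  proof -
    have "(\<Union>k<n. A k) \<in> D" for n
      using that \<open>{} \<in> D\<close> by (induction n) (auto simp: lessThan_Suc intro!: un)
    moreover have "(\<lambda>n. indicator (\<Union>k<n. A k) x :: complex) \<longlonglongrightarrow> indicator (\<Union>n. A n) x" for x
      by (rule LIMSEQ_indicator_UN)
    ultimately show ?thesis
      unfolding D_def mem_Collect_eq
      by (rule trig_approximable_lim[where C = 1]) (simp add: indicator_def)
  qed
  then interpret sigma_algebra UNIV D
    using \<open>{} \<in> D\<close> compl un by (intro sigma_algebra_iff2[THEN iffD2]) auto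
  define N where "N = sigma UNIV D"
  have sets_N: "sets N = D" and space_N: "space N = UNIV"
    by (simp_all add: N_def)
  \<comment> \<open>This is the identity from the space with \<sigma>-algebra \<open>D\<close> to
    the product space; its measurability says that every measurable set lies in
    \<open>D\<close>.\<close>
  have "(\<lambda>x i. x i) \<in> N \<rightarrow>\<^sub>M (\<Pi>\<^sub>M i\<in>UNIV. borel :: real measure)"
  proof (rule measurable_PiM_single')
    show "(\<lambda>x. x i) \<in> borel_measurable N" for i :: int
      unfolding borel_measurable_iff_greater sets_N space_N D_def
      using trig_approximable_indicator_greater by simp
  qed auto
  from measurable_sets[OF this, of A] assms show ?thesis
    by (simp add: path_space_def sets_N space_N D_def)
qed

end

section \<open>Decay of correlations\<close>

context stationary_law
begin

lemma prob_UNIV [simp]: "prob UNIV = 1"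
  using prob_space by simp

text \<open>Bilinear, without a conjugate: the product of two exponentials is then the exponential
  of the sum, as in the covariance inequality.\<close>

definition corr :: "int \<Rightarrow> ((int \<Rightarrow> real) \<Rightarrow> complex) \<Rightarrow> ((int \<Rightarrow> real) \<Rightarrow> complex) \<Rightarrow> complex" where
  "corr n f g = (\<integral>x. f x * g (shift n x) \<partial>P) - (\<integral>x. f x \<partial>P) * (\<integral>x. g x \<partial>P)"

lemma integrable_mult_shift:
  "bounded_measurable f \<Longrightarrow> bounded_measurable g \<Longrightarrow> integrable P (\<lambda>x. f x * g (shift n x))"
  by (intro integrable_bounded_measurable bounded_measurable_mult bounded_measurable_shift)

lemma corr_add_left:
  assumes "bounded_measurable f" "bounded_measurable f'" "bounded_measurable g"
  shows "corr n (\<lambda>x. f x + f' x) g = corr n f g + corr n f' g"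
  using assms by (simp add: corr_def distrib_right integrable_mult_shift integrable_bounded_measurable)

lemma corr_add_right:
  assumes "bounded_measurable f" "bounded_measurable g" "bounded_measurable g'"
  shows "corr n f (\<lambda>x. g x + g' x) = corr n f g + corr n f g'"
  using assms by (simp add: corr_def distrib_left integrable_mult_shift integrable_bounded_measurable)

lemma corr_scale_left: "corr n (\<lambda>x. c * f x) g = c * corr n f g"
  by (simp add: corr_def mult.assoc right_diff_distrib)

lemma corr_scale_right: "corr n f (\<lambda>x. c * g x) = c * corr n f g"
  by (simp add: corr_def mult.left_commute right_diff_distrib)

text \<open>L^1 norm on one factor, sup norm on the other, and no dependence on n: the error of an
  L^1 approximation is uniform over all lags.\<close>

lemma cmod_corr_le_left:
  assumes f: "bounded_measurable f" and g: "bounded_measurable g" and C: "\<And>x. cmod (g x) \<le> C"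
  shows "cmod (corr n f g) \<le> 2 * C * (\<integral>x. cmod (f x) \<partial>P)"
proof -
  have C0: "0 \<le> C" using C norm_ge_zero order_trans by blast
  note int = integrable_bounded_measurable[OF f]
  have "cmod (\<integral>x. f x * g (shift n x) \<partial>P) \<le> (\<integral>x. C * cmod (f x) \<partial>P)"
    using C int f g by (intro order_trans[OF integral_norm_bound] integral_mono integrable_norm
        integrable_mult_shift) (auto simp: norm_mult mult.commute[of C] intro!: mult_left_mono)
  moreover have "cmod ((\<integral>x. f x \<partial>P) * (\<integral>x. g x \<partial>P)) \<le> (\<integral>x. cmod (f x) \<partial>P) * C"
    unfolding norm_mult
  proof (intro mult_mono integral_norm_bound)
    have "cmod (\<integral>x. g x \<partial>P) \<le> (\<integral>x. C \<partial>P)"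
      using C integrable_bounded_measurable[OF g]
      by (intro order_trans[OF integral_norm_bound] integral_mono integrable_norm) auto
    then show "cmod (\<integral>x. g x \<partial>P) \<le> C" by (simp add: prob_space)
  qed auto
  ultimately have "cmod (\<integral>x. f x * g (shift n x) \<partial>P) + cmod ((\<integral>x. f x \<partial>P) * (\<integral>x. g x \<partial>P))
      \<le> 2 * C * (\<integral>x. cmod (f x) \<partial>P)"
    using int by (simp add: mult.commute[of _ C] mult.assoc del: norm_mult)
  then show ?thesis
    unfolding corr_def by (rule order_trans[OF norm_triangle_ineq4])
qed

text \<open>Invariance under the shift by n moves the shift to the other factor.\<close>

lemma corr_swap:
  assumes f: "bounded_measurable f" and g: "bounded_measurable g"
  shows "corr n f g = corr (- n) g f"
proof -
  have "(\<lambda>x. f (shift (- n) x) * g x) \<in> borel_measurable path_space"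
    using bounded_measurable_mult[OF bounded_measurable_shift[OF f] g]
    by (simp add: bounded_measurable_def)
  from integral_shift[OF this, of n] show ?thesis
    by (simp add: corr_def mult.commute)
qed

lemma cmod_corr_le_right:
  assumes f: "bounded_measurable f" and g: "bounded_measurable g" and C: "\<And>x. cmod (f x) \<le> C"
  shows "cmod (corr n f g) \<le> 2 * C * (\<integral>x. cmod (g x) \<partial>P)"
  unfolding corr_swap[OF f g] by (rule cmod_corr_le_left[OF g f C])

text \<open>\<open>f\<close> is replaced against \<open>g\<close>, then \<open>g\<close> against
  \<open>p\<close>; hence the sup norm of the approximant \<open>p\<close>, not that of
  \<open>f\<close>, multiplies the second error.\<close>

lemma cmod_corr_diff_le:
  assumes f: "bounded_measurable f" and g: "bounded_measurable g"
    and p: "bounded_measurable p" and q: "bounded_measurable q"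
    and G: "\<And>x. cmod (g x) \<le> G" and H: "\<And>x. cmod (p x) \<le> H"
  shows "cmod (corr n f g - corr n p q)
    \<le> 2 * G * (\<integral>x. cmod (f x - p x) \<partial>P) + 2 * H * (\<integral>x. cmod (g x - q x) \<partial>P)"
proof -
  have "corr n f g = corr n (\<lambda>x. f x - p x) g + corr n p g"
    using corr_add_left[OF bounded_measurable_diff[OF f p] p g, of n] by simp
  moreover have "corr n p g = corr n p (\<lambda>x. g x - q x) + corr n p q"
    using corr_add_right[OF p bounded_measurable_diff[OF g q] q, of n] by simp
  ultimately have "corr n f g - corr n p q = corr n (\<lambda>x. f x - p x) g + corr n p (\<lambda>x. g x - q x)"
    by simp
  also have "cmod \<dots> \<le> cmod (corr n (\<lambda>x. f x - p x) g) + cmod (corr n p (\<lambda>x. g x - q x))"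
    by (rule norm_triangle_ineq)
  finally show ?thesis
    using cmod_corr_le_left[OF bounded_measurable_diff[OF f p] g G, of n]
      cmod_corr_le_right[OF p bounded_measurable_diff[OF g q] H, of n] by linarith
qed

lemma corr_indicator:
  assumes A: "A \<in> sets path_space" and B: "B \<in> sets path_space"
  shows "corr n (indicator A) (indicator B)
    = of_real (measure P (A \<inter> shift n -` B) - measure P A * measure P B)"
proof -
  have B': "shift n -` B \<in> sets path_space"
    using measurable_sets[OF measurable_shift B, of n] by simp
  have int: "(\<integral>x. indicator A x \<partial>P) = complex_of_real (prob A)" if "A \<in> sets path_space" for A
  proof -
    have "(\<integral>x. indicator A x \<partial>P) = (\<integral>x. complex_of_real (indicator A x) \<partial>P)"
      by (intro Bochner_Integration.integral_cong) (auto simp: indicator_def)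
    then show ?thesis using that by (simp only: integral_complex_of_real) (simp add: sets_P)
  qed
  have "indicator A x * indicator B (shift n x) = (indicator (A \<inter> shift n -` B) x :: complex)" for x
    by (auto simp: indicator_def)
  then show ?thesis
    unfolding corr_def using int[OF A] int[OF B] int[OF sets.Int[OF A B']] by simp
qed

text \<open>The weights \<open>W N\<close> treat convergence (\<open>W N = \<delta>\<^sub>N\<close>) and Cesaro convergence
  (\<open>W N n = 1 / (N + 1)\<close>) of the correlations at the same time.\<close>

lemma weighted_corr_indicator_tendsto:
  fixes W :: "nat \<Rightarrow> nat \<Rightarrow> real"
  assumes W: "\<And>N n. 0 \<le> W N n" "\<And>N. (\<Sum>n\<le>N. W N n) \<le> 1"
    and iexp: "\<And>I J a b. finite I \<Longrightarrow> finite J \<Longrightarrow>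
      (\<lambda>N. \<Sum>n\<le>N. W N n * corr (int n) (\<lambda>x. iexp (\<Sum>i\<in>I. a i * x i)) (\<lambda>x. iexp (\<Sum>j\<in>J. b j * x j)))
        \<longlonglongrightarrow> 0"
    and A: "A \<in> sets path_space" and B: "B \<in> sets path_space"
  shows "(\<lambda>N. \<Sum>n\<le>N. W N n * corr (int n) (indicator A) (indicator B)) \<longlonglongrightarrow> 0"
proof -
  have poly: "(\<lambda>N. \<Sum>n\<le>N. W N n * corr (int n) p q) \<longlonglongrightarrow> 0"
    if "trig_poly p" "trig_poly q" for p q
    using that
  proof (induction p)
    case p: (iexp I a)
    have bp: "bounded_measurable (\<lambda>x. iexp (\<Sum>i\<in>I. a i * x i))"
      by (intro trig_poly_bounded_measurable trig_poly.iexp p)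
    from \<open>trig_poly q\<close> show ?case
    proof (induction q)
      case q: (iexp J b)
      show ?case by (rule iexp[OF p(1) q])
    next
      case (add q r)
      note add_right = corr_add_right[OF bp trig_poly_bounded_measurable[OF add.hyps(1)]
          trig_poly_bounded_measurable[OF add.hyps(2)]]
      from tendsto_add[OF add.IH] show ?case
        by (simp only: add_right distrib_left sum.distrib add_0)
    next
      case (scale q c)
      from tendsto_mult[OF tendsto_const[of c] scale.IH] show ?case
        by (simp only: corr_scale_right sum_distrib_left mult.left_commute[of _ c] mult_zero_right)
    qed
  next
    case (add p r)
    note add_left = corr_add_left[OF trig_poly_bounded_measurable[OF add.hyps(1)]
        trig_poly_bounded_measurable[OF add.hyps(2)] trig_poly_bounded_measurable[OF add.prems]]
    from tendsto_add[OF add.IH[OF add.prems]] show ?case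
      by (simp only: add_left distrib_left sum.distrib add_0)
  next
    case (scale p c)
    from tendsto_mult[OF tendsto_const[of c] scale.IH[OF scale.prems]] show ?case
      by (simp only: corr_scale_left sum_distrib_left mult.left_commute[of _ c] mult_zero_right)
  qed
  define S where "S f g N = (\<Sum>n\<le>N. W N n * corr (int n) f g)" for f g N
  let ?A = "indicator A :: _ \<Rightarrow> complex" and ?B = "indicator B :: _ \<Rightarrow> complex"
  note bA = bounded_measurable_indicator[OF A] and bB = bounded_measurable_indicator[OF B]
  have "\<forall>\<^sub>F N in sequentially. cmod (S ?A ?B N) < e" if "e > 0" for e
  proof -
    \<comment> \<open>\<open>p\<close> precedes \<open>q\<close>, whose precision depends on the
      bound \<open>H\<close> of \<open>p\<close>. The two errors are at most e / 3 each, which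
      leaves e / 3 for the correlations of \<open>p\<close> and \<open>q\<close>.\<close>
    obtain p where p: "trig_poly p" "bounded_measurable p" "(\<integral>x. cmod (?A x - p x) \<partial>P) < e / 6"
      using trig_approximableD[OF trig_approximable_indicator[OF A], of "e / 6"] \<open>e > 0\<close> by auto
    obtain H where H: "H > 0" "\<And>x. cmod (p x) \<le> H" by (rule bounded_measurableE[OF p(2)]) blast
    obtain q where q: "trig_poly q" "bounded_measurable q" "(\<integral>x. cmod (?B x - q x) \<partial>P) < e / (6 * H)"
      using trig_approximableD[OF trig_approximable_indicator[OF B], of "e / (6 * H)"] \<open>e > 0\<close> H by auto
    have close: "cmod (corr (int n) ?A ?B - corr (int n) p q) \<le> 2 * e / 3" for n
    proof -
      have "cmod (corr (int n) ?A ?B - corr (int n) p q)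
          \<le> 2 * 1 * (\<integral>x. cmod (?A x - p x) \<partial>P) + 2 * H * (\<integral>x. cmod (?B x - q x) \<partial>P)"
        by (intro cmod_corr_diff_le bA bB p q H) (simp add: indicator_def)
      also have "\<dots> \<le> 2 * 1 * (e / 6) + 2 * H * (e / (6 * H))"
        using p(3) q(3) H by (intro add_mono mult_left_mono) auto
      also have "\<dots> = 2 * e / 3" using H by (simp add: field_simps)
      finally show ?thesis .
    qed
    \<comment> \<open>Nonnegative weights of total at most 1 do not enlarge an error that is uniform
      in n.\<close>
    have diff: "cmod (S ?A ?B N - S p q N) \<le> 2 * e / 3" for N
    proof -
      have "S ?A ?B N - S p q N = (\<Sum>n\<le>N. W N n * (corr (int n) ?A ?B - corr (int n) p q))"
        by (simp add: S_def sum_subtractf right_diff_distrib)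
      also have "cmod \<dots> \<le> (\<Sum>n\<le>N. W N n * (2 * e / 3))"
        by (intro sum_norm_le)
          (simp only: norm_mult norm_of_real abs_of_nonneg[OF W(1)], intro mult_left_mono close W(1))
      also have "\<dots> \<le> 1 * (2 * e / 3)"
        unfolding sum_distrib_right[symmetric] using W \<open>e > 0\<close> by (intro mult_right_mono) auto
      finally show ?thesis by simp
    qed
    have "\<forall>\<^sub>F N in sequentially. cmod (S p q N) < e / 3"
      using poly[OF p(1) q(1)] \<open>e > 0\<close> unfolding S_def[symmetric] tendsto_iff dist_norm diff_0_right
      by (metis divide_pos_pos zero_less_numeral)
    then show ?thesis
    proof eventually_elim
      case (elim N)
      have "cmod (S ?A ?B N) \<le> cmod (S ?A ?B N - S p q N) + cmod (S p q N)"
        by (metis diff_add_cancel norm_triangle_ineq)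
      then show ?case using diff[of N] elim \<open>e > 0\<close> by linarith
    qed
  qed
  then show ?thesis unfolding S_def[symmetric] by (simp add: tendsto_iff dist_norm)
qed

end

section \<open>Covariances of a square integrable law\<close>

locale square_integrable_law = stationary_law +
  assumes square_integrable_0: "integrable P (\<lambda>x. (x 0)\<^sup>2)"
begin

lemma coord_measurable [measurable]: "(\<lambda>x. x i) \<in> borel_measurable P"
  by (subst measurable_cong_sets[OF sets_P refl]) (rule measurable_coordinate)

lemma square_integrable: "integrable P (\<lambda>x. (x i)\<^sup>2)"
  using integrable_shift[OF square_integrable_0, of i] by (simp add: shift_def)

lemma integrable_coord: "integrable P (\<lambda>x. x i)"
  by (rule square_integrable_imp_integrable[OF coord_measurable square_integrable])

lemma integral_coord: "(\<integral>x. x i \<partial>P) = (\<integral>x. x 0 \<partial>P)"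
  using integral_shift[OF measurable_coordinate[of 0], of i] by (simp add: shift_def)

definition cov :: "int \<Rightarrow> real" where
  "cov n = (\<integral>x. x n * x 0 \<partial>P) - (\<integral>x. x 0 \<partial>P)\<^sup>2"

lemma cov_eq: "(\<integral>x. x i * x j \<partial>P) - (\<integral>x. x i \<partial>P) * (\<integral>x. x j \<partial>P) = cov (i - j)"
proof -
  have "(\<lambda>x::int \<Rightarrow> real. x (i - j) * x 0) \<in> borel_measurable path_space" by measurable
  from integral_shift[OF this, of j] show ?thesis
    unfolding cov_def integral_coord[of i] integral_coord[of j] by (simp add: shift_def power2_eq_square)
qed

lemma cov_minus: "cov (- n) = cov n"
  using cov_eq[of 0 n] cov_eq[of n 0] by (simp add: mult.commute)

text \<open>With the second index map j + n, the covariance inequality bounds each correlation of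
  exponentials by a finite combination of cov (n + (j - i)). The differences j - i are why decay is
  assumed at every offset m. The coefficients do not depend on n, so weighted sums pass through the
  bound.\<close>

lemma weighted_corr_tendsto_if_cov:
  fixes W :: "nat \<Rightarrow> nat \<Rightarrow> real" and \<epsilon> d :: real
  assumes inf_div: "infinitely_divisible P" and \<epsilon>: "\<epsilon> \<in> {-1, 1}" and nonneg: "AE x in P. \<epsilon> * x 0 + d \<ge> 0"
    and W: "\<And>N n. 0 \<le> W N n" "\<And>N. (\<Sum>n\<le>N. W N n) \<le> 1"
    and cov: "\<And>m. (\<lambda>N. \<Sum>n\<le>N. W N n * cov (int n + m)) \<longlonglongrightarrow> 0"
    and A: "A \<in> sets path_space" and B: "B \<in> sets path_space"
  shows "(\<lambda>N. \<Sum>n\<le>N. W N n * corr (int n) (indicator A) (indicator B)) \<longlonglongrightarrow> 0"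
proof (rule weighted_corr_indicator_tendsto[OF W _ A B])
  fix I J :: "int set" and a b :: "int \<Rightarrow> real"
  have "AE x in P. \<epsilon> * x i + d \<ge> 0" for i
    using AE_shift[OF nonneg, of i] by (simp add: shift_def)
  note le = infinitely_divisible_cmod_covariance_le[OF prob_space_axioms sets_P inf_div \<epsilon> this
      square_integrable]
  let ?f = "\<lambda>x. iexp (\<Sum>i\<in>I. a i * x i)" and ?g = "\<lambda>x. iexp (\<Sum>j\<in>J. b j * x j)"
  have corr_le: "cmod (corr n ?f ?g) \<le> (\<Sum>i\<in>I. \<Sum>j\<in>J. \<bar>a i\<bar> * \<bar>b j\<bar> * cov (n + (j - i)))" for n
  proof -
    have "?g \<in> borel_measurable path_space" by measurable
    from integral_shift[OF this, of n] have "corr n ?f ?g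
        = (\<integral>x. iexp ((\<Sum>i\<in>I. a i * x i) + (\<Sum>j\<in>J. b j * x (j + n))) \<partial>P)
          - (\<integral>x. iexp (\<Sum>i\<in>I. a i * x i) \<partial>P) * (\<integral>x. iexp (\<Sum>j\<in>J. b j * x (j + n)) \<partial>P)"
      by (simp only: corr_def of_real_add distrib_left exp_add shift_def)
    \<comment> \<open>\<open>cov\<close> is even, so the lag can be written with +n.\<close>
    moreover have "cov (i - (j + n)) = cov (n + (j - i))" for i j
      using cov_minus[of "n + (j - i)"] by (simp add: algebra_simps)
    ultimately show ?thesis
      using le[where I = I and J = J and a = a and p = "\<lambda>i. i" and b = b and q = "\<lambda>j. j + n"] by (simp only: cov_eq)
  qed
  have bound: "cmod (\<Sum>n\<le>N. W N n * corr (int n) ?f ?g)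
      \<le> (\<Sum>i\<in>I. \<Sum>j\<in>J. \<bar>a i\<bar> * \<bar>b j\<bar> * (\<Sum>n\<le>N. W N n * cov (int n + (j - i))))" for N
  proof -
    have "cmod (\<Sum>n\<le>N. W N n * corr (int n) ?f ?g)
        \<le> (\<Sum>n\<le>N. W N n * (\<Sum>i\<in>I. \<Sum>j\<in>J. \<bar>a i\<bar> * \<bar>b j\<bar> * cov (int n + (j - i))))"
      by (intro sum_norm_le)
        (simp only: norm_mult norm_of_real abs_of_nonneg[OF W(1)], intro mult_left_mono corr_le W(1))
    also have "\<dots> = (\<Sum>i\<in>I. \<Sum>n\<le>N. \<Sum>j\<in>J. W N n * (\<bar>a i\<bar> * \<bar>b j\<bar> * cov (int n + (j - i))))"
      unfolding sum_distrib_left by (rule sum.swap)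
    also have "\<dots> = (\<Sum>i\<in>I. \<Sum>j\<in>J. \<Sum>n\<le>N. W N n * (\<bar>a i\<bar> * \<bar>b j\<bar> * cov (int n + (j - i))))"
      by (rule sum.cong[OF refl sum.swap])
    also have "\<dots> = (\<Sum>i\<in>I. \<Sum>j\<in>J. \<bar>a i\<bar> * \<bar>b j\<bar> * (\<Sum>n\<le>N. W N n * cov (int n + (j - i))))"
      unfolding sum_distrib_left by (simp only: mult.left_commute)
    finally show ?thesis .
  qed
  have "(\<lambda>N. \<Sum>i\<in>I. \<Sum>j\<in>J. \<bar>a i\<bar> * \<bar>b j\<bar> * (\<Sum>n\<le>N. W N n * cov (int n + (j - i))))
      \<longlonglongrightarrow> (\<Sum>i\<in>I. \<Sum>j\<in>J. \<bar>a i\<bar> * \<bar>b j\<bar> * 0)"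
    by (intro tendsto_sum tendsto_mult tendsto_const cov)
  then have "(\<lambda>N. \<Sum>i\<in>I. \<Sum>j\<in>J. \<bar>a i\<bar> * \<bar>b j\<bar> * (\<Sum>n\<le>N. W N n * cov (int n + (j - i)))) \<longlonglongrightarrow> 0"
    by (simp only: mult_zero_right sum.neutral_const)
  then show "(\<lambda>N. \<Sum>n\<le>N. W N n * corr (int n) ?f ?g) \<longlonglongrightarrow> 0"
    by (rule Lim_null_comparison[OF always_eventually[OF allI[OF bound]]])
qed

end

section \<open>Mixing and ergodicity from the covariance\<close>

context square_integrable_law
begin

lemma mixing_law_if_cov_tendsto_0:
  fixes \<epsilon> d :: real
  assumes inf_div: "infinitely_divisible P" and \<epsilon>: "\<epsilon> \<in> {-1, 1}" and nonneg: "AE x in P. \<epsilon> * x 0 + d \<ge> 0"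
    and cov: "(\<lambda>n. cov (int n)) \<longlonglongrightarrow> 0"
  shows "mixing_law P"
  unfolding mixing_law_def sets_P
proof (intro ballI)
  fix A B assume A: "A \<in> sets path_space" and B: "B \<in> sets path_space"
  define W :: "nat \<Rightarrow> nat \<Rightarrow> real" where "W N n = (if n = N then 1 else 0)" for N n
  have W_sum: "(\<Sum>n\<le>N. W N n * u n) = u N" for N and u :: "nat \<Rightarrow> real"
  proof -
    have "(\<Sum>n\<le>N. W N n * u n) = (\<Sum>n\<le>N. if n = N then u n else 0)"
      by (intro sum.cong) (auto simp: W_def)
    then show ?thesis by simp
  qed
  have W_sum': "(\<Sum>n\<le>N. W N n * u n) = u N" for N and u :: "nat \<Rightarrow> complex"
  proof -
    have "(\<Sum>n\<le>N. W N n * u n) = (\<Sum>n\<le>N. if n = N then u n else 0)"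
      by (intro sum.cong) (auto simp: W_def)
    then show ?thesis by simp
  qed
  \<comment> \<open>For negative m the lag \<open>int N + m\<close> is nonnegative only from some N
    on, so the hypothesis is reached through \<open>nat\<close>.\<close>
  have shifted: "(\<lambda>N. cov (int N + m)) \<longlonglongrightarrow> 0" for m
  proof -
    have "\<forall>\<^sub>F N in sequentially. cov (int (nat (int N + m))) = cov (int N + m)"
      unfolding eventually_sequentially by (rule exI[of _ "nat (- m)"]) auto
    moreover have "filterlim (\<lambda>N. nat (int N + m)) sequentially sequentially"
      unfolding filterlim_sequentially_iff_filterlim_real filterlim_at_top eventually_sequentially
    proof
      fix Z :: real
      show "\<exists>N. \<forall>n\<ge>N. Z \<le> real (nat (int n + m))"
        by (rule exI[of _ "nat (\<lceil>Z\<rceil> - m)"]) linarith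
    qed
    ultimately show ?thesis
      using filterlim_compose[OF cov] by (blast intro: Lim_transform_eventually)
  qed
  have "(\<lambda>N. \<Sum>n\<le>N. W N n * corr (int n) (indicator A) (indicator B)) \<longlonglongrightarrow> 0"
  proof (rule weighted_corr_tendsto_if_cov[OF inf_div \<epsilon> nonneg _ _ _ A B])
    show "(\<Sum>n\<le>N. W N n) \<le> 1" for N using W_sum[of N "\<lambda>_. 1"] by simp
    show "0 \<le> W N n" for N n by (simp add: W_def)
    show "(\<lambda>N. \<Sum>n\<le>N. W N n * cov (int n + m)) \<longlonglongrightarrow> 0" for m
      unfolding W_sum by (rule shifted)
  qed
  then have "(\<lambda>n. complex_of_real (measure P (A \<inter> shift (int n) -` B) - measure P A * measure P B)) \<longlonglongrightarrow> of_real 0"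
    unfolding W_sum' corr_indicator[OF A B] by simp
  then have "(\<lambda>n. measure P (A \<inter> shift (int n) -` B) - measure P A * measure P B) \<longlonglongrightarrow> 0"
    by (simp only: tendsto_of_real_iff)
  then show "(\<lambda>n. measure P (A \<inter> (shift (int n) -` B \<inter> space P))) \<longlonglongrightarrow> measure P A * measure P B"
    by (simp add: LIM_zero_iff)
qed

text \<open>For an invariant set A the correlation of A with itself is P(A) - P(A)^2 at every lag;
  it equals its own Cesaro mean, which tends to 0.\<close>

lemma ergodic_law_if_cesaro_cov_tendsto_0:
  fixes \<epsilon> d :: real
  assumes inf_div: "infinitely_divisible P" and \<epsilon>: "\<epsilon> \<in> {-1, 1}" and nonneg: "AE x in P. \<epsilon> * x 0 + d \<ge> 0"
    and cov: "\<And>m. (\<lambda>N. (\<Sum>n\<le>N. cov (int n + m)) / real (Suc N)) \<longlonglongrightarrow> 0"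
  shows "ergodic_law P"
  unfolding ergodic_law_def sets_P
proof (intro ballI impI)
  fix A assume A: "A \<in> sets path_space" and inv: "shift 1 -` A \<inter> space P = A"
  have inv_n: "shift (int n) -` A = A" for n
  proof (induction n)
    case (Suc n)
    have "shift (int (Suc n)) -` A = shift (int n) -` (shift 1 -` A)"
      by (auto simp: add.commute)
    then show ?case using Suc inv by simp
  qed auto
  have "(\<lambda>N. \<Sum>n\<le>N. (1 / real (Suc N)) * corr (int n) (indicator A) (indicator A)) \<longlonglongrightarrow> 0"
  proof (rule weighted_corr_tendsto_if_cov[OF inf_div \<epsilon> nonneg _ _ _ A A])
    show "(\<lambda>N. \<Sum>n\<le>N. 1 / real (Suc N) * cov (int n + m)) \<longlonglongrightarrow> 0" for m
      using cov[of m] by (simp add: sum_divide_distrib)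
  qed auto
  moreover have "(\<Sum>n\<le>N. (1 / real (Suc N)) * corr (int n) (indicator A) (indicator A))
      = of_real (measure P A - measure P A * measure P A)" for N
    unfolding corr_indicator[OF A A] inv_n Int_absorb sum_constant
    by (simp add: field_simps del: of_nat_Suc)
  ultimately have "of_real (measure P A - measure P A * measure P A) = (0 :: complex)"
    by (simp only: LIMSEQ_const_iff)
  then have "measure P A * (1 - measure P A) = 0"
    unfolding of_real_eq_0_iff by (simp add: algebra_simps)
  then show "measure P A = 0 \<or> measure P A = 1" by auto
qed

text \<open>Young's inequality, once under the integral and once for the two means, with half of the
  bound each. The free parameter \<delta> shifts the weight to either factor, and stationarity makes
  the bound the same for all n.\<close>

lemma abs_cov_le:
  fixes u v :: "(int \<Rightarrow> real) \<Rightarrow> real"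
  assumes [measurable]: "u \<in> borel_measurable path_space" "v \<in> borel_measurable path_space"
    and u2: "integrable P (\<lambda>x. (u x)\<^sup>2)" and v2: "integrable P (\<lambda>x. (v x)\<^sup>2)" and "\<delta> > 0"
  shows "\<bar>(\<integral>x. u x * v (shift n x) \<partial>P) - (\<integral>x. u x \<partial>P) * (\<integral>x. v x \<partial>P)\<bar>
    \<le> (\<integral>x. (u x)\<^sup>2 \<partial>P) / \<delta> + \<delta> * (\<integral>x. (v x)\<^sup>2 \<partial>P)"
proof -
  have amgm: "\<bar>a * b\<bar> \<le> (a\<^sup>2 / \<delta> + \<delta> * b\<^sup>2) / 2" for a b :: real
  proof -
    have "2 * \<bar>a\<bar> * (\<delta> * \<bar>b\<bar>) \<le> \<bar>a\<bar>\<^sup>2 + (\<delta> * \<bar>b\<bar>)\<^sup>2"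
      by (rule sum_squares_bound)
    then have "2 * \<delta> * \<bar>a * b\<bar> \<le> a\<^sup>2 + \<delta>\<^sup>2 * b\<^sup>2"
      by (simp add: abs_mult power_mult_distrib mult_ac)
    then have "2 * \<delta> * \<bar>a * b\<bar> / (2 * \<delta>) \<le> (a\<^sup>2 + \<delta>\<^sup>2 * b\<^sup>2) / (2 * \<delta>)"
      using \<open>\<delta> > 0\<close> by (intro divide_right_mono) auto
    moreover have "(a\<^sup>2 + \<delta>\<^sup>2 * b\<^sup>2) / (2 * \<delta>) = (a\<^sup>2 / \<delta> + \<delta> * b\<^sup>2) / 2"
      using \<open>\<delta> > 0\<close> by (simp add: add_divide_distrib power2_eq_square)
    ultimately show ?thesis using \<open>\<delta> > 0\<close> by simp
  qed
  have v2': "integrable P (\<lambda>x. (v (shift n x))\<^sup>2)" by (rule integrable_shift[OF v2])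
  have v2_eq: "(\<integral>x. (v (shift n x))\<^sup>2 \<partial>P) = (\<integral>x. (v x)\<^sup>2 \<partial>P)" by (rule integral_shift) measurable
  have "\<bar>\<integral>x. u x * v (shift n x) \<partial>P\<bar> \<le> (\<integral>x. ((u x)\<^sup>2 / \<delta> + \<delta> * (v (shift n x))\<^sup>2) / 2 \<partial>P)"
  proof (intro order_trans[OF integral_abs_bound] integral_mono amgm)
    show "integrable P (\<lambda>x. \<bar>u x * v (shift n x)\<bar>)"
      by (intro integrable_abs integrable_mult_square_integrable u2 v2') measurable
    show "integrable P (\<lambda>x. ((u x)\<^sup>2 / \<delta> + \<delta> * (v (shift n x))\<^sup>2) / 2)"
      using u2 v2' by simp
  qed
  also have "\<dots> = ((\<integral>x. (u x)\<^sup>2 \<partial>P) / \<delta> + \<delta> * (\<integral>x. (v x)\<^sup>2 \<partial>P)) / 2"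
    using u2 v2' by (simp add: v2_eq)
  finally have 1: "\<bar>\<integral>x. u x * v (shift n x) \<partial>P\<bar>
      \<le> ((\<integral>x. (u x)\<^sup>2 \<partial>P) / \<delta> + \<delta> * (\<integral>x. (v x)\<^sup>2 \<partial>P)) / 2" .
  have sq_le: "(\<integral>x. w x \<partial>P)\<^sup>2 \<le> (\<integral>x. (w x)\<^sup>2 \<partial>P)"
    if [measurable]: "w \<in> borel_measurable path_space" and w: "integrable P (\<lambda>x. (w x)\<^sup>2)" for w :: "_ \<Rightarrow> real"
  proof -
    have "integrable P w"
      by (rule square_integrable_imp_integrable[OF _ w]) measurable
    then show ?thesis
      using variance_eq[OF _ w] variance_positive[of w] by linarith
  qed
  have "\<bar>(\<integral>x. u x \<partial>P) * (\<integral>x. v x \<partial>P)\<bar> \<le> ((\<integral>x. u x \<partial>P)\<^sup>2 / \<delta> + \<delta> * (\<integral>x. v x \<partial>P)\<^sup>2) / 2"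
    by (rule amgm)
  also have "\<dots> \<le> ((\<integral>x. (u x)\<^sup>2 \<partial>P) / \<delta> + \<delta> * (\<integral>x. (v x)\<^sup>2 \<partial>P)) / 2"
    using sq_le[OF _ u2] sq_le[OF _ v2] \<open>\<delta> > 0\<close>
    by (intro divide_right_mono add_mono mult_left_mono) simp_all
  finally have 2: "\<bar>(\<integral>x. u x \<partial>P) * (\<integral>x. v x \<partial>P)\<bar>
      \<le> ((\<integral>x. (u x)\<^sup>2 \<partial>P) / \<delta> + \<delta> * (\<integral>x. (v x)\<^sup>2 \<partial>P)) / 2" .
  have "\<bar>a - b\<bar> \<le> c" if "\<bar>a\<bar> \<le> c / 2" "\<bar>b\<bar> \<le> c / 2" for a b c :: real
    using that by linarith
  from this[OF 1 2] show ?thesis .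
qed

text \<open>By bilinearity mixing for sets gives decay for simple functions. Approximating x 0 by
  them in L^2 leaves two error terms that are small uniformly in n, so the limit in n is taken for a
  fixed approximant.\<close>

lemma cov_tendsto_0_if_mixing_law:
  assumes mixing: "mixing_law P"
  shows "(\<lambda>n. cov (int n)) \<longlonglongrightarrow> 0"
proof -
  define f where "f x = x 0" for x :: "int \<Rightarrow> real"
  define C where "C n u v = (\<integral>x. u x * v (shift (int n) x) \<partial>P) - (\<integral>x. u x \<partial>P) * (\<integral>x. v x \<partial>P)"
    for n and u v :: "(int \<Rightarrow> real) \<Rightarrow> real"
  have [measurable]: "f \<in> borel_measurable path_space" unfolding f_def by measurable
  have f2: "integrable P (\<lambda>x. (f x)\<^sup>2)" unfolding f_def by (rule square_integrable_0)
  have cov_C: "cov (int n) = C n f f" for n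
    unfolding C_def cov_def f_def by (simp add: shift_def power2_eq_square mult.commute)
  define V where "V = (\<integral>x. (f x)\<^sup>2 \<partial>P)"
  have "V \<ge> 0" unfolding V_def by simp
  \<comment> \<open>Domination by 2 |f| yields the integrable bounds 4 f^2 for s^2 and 9 f^2 for (f
    - s)^2.\<close>
  obtain s where s: "\<And>k. simple_function P (s k)" "\<And>x. (\<lambda>k. s k x) \<longlonglongrightarrow> f x"
    "\<And>k x. \<bar>s k x\<bar> \<le> 2 * \<bar>f x\<bar>"
    using borel_measurable_implies_sequence_metric[of f P 0] by (auto simp: dist_norm)
  have [measurable]: "s k \<in> borel_measurable path_space" for k
    using borel_measurable_simple_function[OF s(1)] measurable_cong_sets[OF sets_P refl] by blast
  have s_sq: "(s k x)\<^sup>2 \<le> 4 * (f x)\<^sup>2" for k x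
    using power_mono[OF s(3)[of k x], of 2] by (simp add: power_mult_distrib)
  have s2: "integrable P (\<lambda>x. (s k x)\<^sup>2)" for k
    by (rule Bochner_Integration.integrable_bound[of _ "\<lambda>x. 4 * (f x)\<^sup>2"]) (use f2 s_sq in auto)
  have s_le: "(\<integral>x. (s k x)\<^sup>2 \<partial>P) \<le> 4 * V" for k
    unfolding V_def using integral_mono[OF s2[of k] integrable_mult_right[OF f2, of 4]] s_sq by simp
  have prod: "integrable P (\<lambda>x. u x * v (shift n x))"
    if [measurable]: "u \<in> borel_measurable path_space" "v \<in> borel_measurable path_space"
      and "integrable P (\<lambda>x. (u x)\<^sup>2)" "integrable P (\<lambda>x. (v x)\<^sup>2)" for u v :: "_ \<Rightarrow> real" and n
    using that integrable_shift[OF that(4), of n] by (intro integrable_mult_square_integrable) auto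
  have r_sq: "(f x - s k x)\<^sup>2 \<le> 9 * (f x)\<^sup>2" for k x
  proof -
    have "\<bar>f x - s k x\<bar> \<le> 3 * \<bar>f x\<bar>" using s(3)[of k x] by linarith
    then show ?thesis
      using power_mono[of "\<bar>f x - s k x\<bar>" "3 * \<bar>f x\<bar>" 2] by (simp add: power_mult_distrib)
  qed
  have r2: "integrable P (\<lambda>x. (f x - s k x)\<^sup>2)" for k
  proof (rule Bochner_Integration.integrable_bound)
    show "integrable P (\<lambda>x. 9 * (f x)\<^sup>2)" using f2 by simp
    have "norm ((f x - s k x)\<^sup>2) = (f x - s k x)\<^sup>2" "norm (9 * (f x)\<^sup>2) = 9 * (f x)\<^sup>2" for x
      by (simp_all add: abs_mult)
    note n = this
    show "AE x in P. norm ((f x - s k x)\<^sup>2) \<le> norm (9 * (f x)\<^sup>2)"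
      unfolding n by (intro AE_I2 r_sq)
  qed measurable
  have r_lim: "(\<lambda>k. \<integral>x. (f x - s k x)\<^sup>2 \<partial>P) \<longlonglongrightarrow> (\<integral>x. 0 \<partial>P)"
  proof (rule integral_dominated_convergence[where w = "\<lambda>x. 9 * (f x)\<^sup>2"])
    have "(\<lambda>k. (f x - s k x)\<^sup>2) \<longlonglongrightarrow> (f x - f x)\<^sup>2" for x by (intro tendsto_intros s)
    then show "AE x in P. (\<lambda>k. (f x - s k x)\<^sup>2) \<longlonglongrightarrow> 0" by simp
    show "AE x in P. norm ((f x - s k x)\<^sup>2) \<le> 9 * (f x)\<^sup>2" for k
    proof -
      have "norm ((f x - s k x)\<^sup>2) = (f x - s k x)\<^sup>2" for x by simp
      note n = this
      show ?thesis unfolding n by (intro AE_I2 r_sq)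
    qed
  qed (use f2 in auto)
  have simple: "(\<lambda>n. C n (s k) (s k)) \<longlonglongrightarrow> 0" for k
  proof -
    define Y where "Y = s k ` UNIV"
    define A where "A y = s k -` {y}" for y
    have finY: "finite Y" using s(1)[of k] by (simp add: simple_function_def Y_def)
    have A [measurable]: "A y \<in> sets path_space" for y
      using s(1)[of k, THEN simple_functionD(2), of "{y}"] by (simp add: A_def sets_P)
    have A': "shift n -` A y \<in> sets path_space" for n y
      using measurable_sets[OF measurable_shift A] by simp
    have rep: "s k x = (\<Sum>y\<in>Y. indicator (A y) x * y)" for x
      using simple_function_indicator_representation_banach[OF s(1)[of k], of x]
      unfolding Y_def A_def space_P Int_UNIV_right real_scaleR_def by blast
    have "C n (s k) (s k) = (\<Sum>y\<in>Y. \<Sum>z\<in>Y. y * z *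
        (measure P (A y \<inter> (shift (int n) -` A z \<inter> space P)) - measure P (A y) * measure P (A z)))" for n
    proof -
      have ind: "indicator (A y) x * indicator (A z) (shift (int n) x)
          = (indicator (A y \<inter> shift (int n) -` A z) x :: real)" for y z x
        by (auto simp: indicator_def)
      have "s k x * s k (shift (int n) x)
          = (\<Sum>y\<in>Y. \<Sum>z\<in>Y. y * z * indicator (A y \<inter> shift (int n) -` A z) x)" for x
        unfolding rep sum_product ind[symmetric] by (simp only: mult_ac)
      then have "(\<integral>x. s k x * s k (shift (int n) x) \<partial>P)
          = (\<integral>x. (\<Sum>y\<in>Y. \<Sum>z\<in>Y. y * z * indicator (A y \<inter> shift (int n) -` A z) x) \<partial>P)"
        by simp
      also have "\<dots> = (\<Sum>y\<in>Y. \<Sum>z\<in>Y. y * z * measure P (A y \<inter> shift (int n) -` A z))"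
        using A A' by (subst Bochner_Integration.integral_sum, (subst Bochner_Integration.integral_sum)?)
          (auto intro!: sum.cong Bochner_Integration.integrable_sum integrable_mult_right
            integrable_real_indicator simp: sets_P emeasure_eq_measure)
      finally have 1: "(\<integral>x. s k x * s k (shift (int n) x) \<partial>P)
          = (\<Sum>y\<in>Y. \<Sum>z\<in>Y. y * z * measure P (A y \<inter> shift (int n) -` A z))" .
      have "(\<integral>x. s k x \<partial>P) = (\<integral>x. (\<Sum>y\<in>Y. y * indicator (A y) x) \<partial>P)"
        by (simp only: rep mult.commute)
      also have "\<dots> = (\<Sum>y\<in>Y. y * measure P (A y))"
        using A by (subst Bochner_Integration.integral_sum)
          (auto intro!: integrable_mult_right integrable_real_indicator simp: sets_P emeasure_eq_measure)
      finally have 2: "(\<integral>x. s k x \<partial>P) = (\<Sum>y\<in>Y. y * measure P (A y))" .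
      show ?thesis
        unfolding C_def 1 2 sum_product sum_subtractf[symmetric]
        by (intro sum.cong refl) (simp add: algebra_simps)
    qed
    moreover have "(\<lambda>n. \<Sum>y\<in>Y. \<Sum>z\<in>Y. y * z *
        (measure P (A y \<inter> (shift (int n) -` A z \<inter> space P)) - measure P (A y) * measure P (A z)))
      \<longlonglongrightarrow> (\<Sum>y\<in>Y. \<Sum>z\<in>Y. y * z * (measure P (A y) * measure P (A z) - measure P (A y) * measure P (A z)))"
      using mixing A by (intro tendsto_sum tendsto_mult tendsto_const tendsto_diff)
        (auto simp: mixing_law_def sets_P)
    ultimately show ?thesis by (simp only: diff_self mult_zero_right sum.neutral_const)
  qed
  \<comment> \<open>f f = (f - s) f + s (f - s) + s s, so each error term contains f - s exactly
    once.\<close>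
  have C_diff: "C n f f = C n (\<lambda>x. f x - s k x) f + C n (s k) (\<lambda>x. f x - s k x) + C n (s k) (s k)" for n k
  proof -
    note i = prod[OF _ _ f2 f2] prod[OF _ _ s2[of k] s2[of k]] prod[OF _ _ s2[of k] f2] prod[OF _ _ f2 s2[of k]]
    have i1: "integrable P f" "integrable P (s k)"
      by (rule square_integrable_imp_integrable; use f2 s2 in simp)+
    show ?thesis
      unfolding C_def using i i1 by (simp add: left_diff_distrib right_diff_distrib)
  qed
  show ?thesis unfolding cov_C
  proof (rule LIMSEQ_I)
    fix e :: real assume "e > 0"
    \<comment> \<open>The five copies of \<delta> V in the two error estimates cost at most e / 4,
      the two terms \<eta> / \<delta> another e / 4, and the simple part e / 4. The 1 added to V
      avoids division by 0.\<close>
    define \<delta> where "\<delta> = e / (20 * (V + 1))"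
    have "\<delta> > 0" using \<open>e > 0\<close> \<open>V \<ge> 0\<close> by (simp add: \<delta>_def)
    have "\<forall>\<^sub>F k in sequentially. (\<integral>x. (f x - s k x)\<^sup>2 \<partial>P) < e * \<delta> / 8"
      using r_lim \<open>e > 0\<close> \<open>\<delta> > 0\<close> by (intro order_tendstoD(2)) auto
    then obtain k where k: "(\<integral>x. (f x - s k x)\<^sup>2 \<partial>P) < e * \<delta> / 8"
      by (auto dest: eventually_happens)
    define \<eta> where "\<eta> = (\<integral>x. (f x - s k x)\<^sup>2 \<partial>P)"
    have \<eta>: "\<eta> / \<delta> < e / 8" using k unfolding \<eta>_def[symmetric] using \<open>\<delta> > 0\<close> by (simp add: divide_less_eq)
    have \<delta>V: "\<delta> * V \<le> e / 20" using \<open>V \<ge> 0\<close> \<open>e > 0\<close> by (simp add: \<delta>_def divide_simps)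
    obtain N where N: "\<And>n. n \<ge> N \<Longrightarrow> \<bar>C n (s k) (s k)\<bar> < e / 4"
      using LIMSEQ_D[OF simple[of k], of "e / 4"] \<open>e > 0\<close> by auto
    have "\<bar>C n f f\<bar> < e" if "n \<ge> N" for n
    proof -
      have "\<bar>C n (\<lambda>x. f x - s k x) f\<bar> \<le> \<eta> / \<delta> + \<delta> * V"
        unfolding C_def \<eta>_def V_def by (intro abs_cov_le r2 f2 \<open>\<delta> > 0\<close>) measurable
      \<comment> \<open>The small factor f - s now comes second, so the parameter is 1 / \<delta>
        instead of \<delta>.\<close>
      moreover have "\<bar>C n (s k) (\<lambda>x. f x - s k x)\<bar> \<le> (\<integral>x. (s k x)\<^sup>2 \<partial>P) / (1 / \<delta>) + 1 / \<delta> * \<eta>"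
        unfolding C_def \<eta>_def using \<open>\<delta> > 0\<close> by (intro abs_cov_le r2 s2) auto
      moreover have "(\<integral>x. (s k x)\<^sup>2 \<partial>P) / (1 / \<delta>) + 1 / \<delta> * \<eta> \<le> 4 * (\<delta> * V) + \<eta> / \<delta>"
        using mult_left_mono[OF s_le[of k], of \<delta>] \<open>\<delta> > 0\<close> by (simp add: algebra_simps)
      ultimately show ?thesis
        using N[OF that] \<eta> \<delta>V unfolding C_diff[of n k] by linarith
    qed
    then show "\<exists>N. \<forall>n\<ge>N. norm (C n f f - 0) < e" by auto
  qed
qed

end

section \<open>The spectral measure and the mean ergodic theorem\<close>

text \<open>In L^2 of the spectral measure this function represents the mean of the centred
  coordinates 0 to N.\<close>

definition cesaro_kernel :: "nat \<Rightarrow> real \<Rightarrow> complex" where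
  "cesaro_kernel N t = (\<Sum>n\<le>N. of_real (1 / real (Suc N)) * iexp (real n * t))"

lemma cesaro_kernel_measurable [measurable]: "cesaro_kernel N \<in> borel_measurable borel"
  unfolding cesaro_kernel_def by measurable

lemma cmod_cesaro_kernel_le: "cmod (cesaro_kernel N t) \<le> 1"
proof -
  have "cmod (cesaro_kernel N t) \<le> (\<Sum>n\<le>N. 1 / real (Suc N))"
    unfolding cesaro_kernel_def
    by (rule sum_norm_le) (simp only: norm_mult norm_exp_i_times norm_of_real, simp)
  then show ?thesis by simp
qed

text \<open>Off 0 the geometric sum is bounded by 2 / |1 - z| and gets divided by N + 1. On [-pi,
  pi[ the only multiple of 2 pi is 0, so no other point survives.\<close>

lemma cesaro_kernel_tendsto:
  assumes "t \<in> {-pi..<pi}"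
  shows "(\<lambda>N. cesaro_kernel N t) \<longlonglongrightarrow> indicator {0} t"
proof (cases "t = 0")
  case True
  have "cesaro_kernel N 0 = 1" for N
    unfolding cesaro_kernel_def by (simp del: of_nat_Suc)
  then show ?thesis using True by simp
next
  case False
  define z where "z = iexp t"
  have "z \<noteq> 1"
  proof
    assume "z = 1"
    then obtain k :: int where k: "t = of_int (2 * k) * pi"
      unfolding z_def exp_eq_1 by auto
    have "\<bar>t\<bar> \<le> pi" using assms by auto
    then have "\<bar>real_of_int (2 * k)\<bar> * pi \<le> 1 * pi" unfolding k by (simp add: abs_mult)
    then have "\<bar>real_of_int (2 * k)\<bar> \<le> 1" by (rule mult_right_le_imp_le) simp
    then have "k = 0" by linarith
    then show False using k False by simp
  qed
  have kernel: "cesaro_kernel N t = of_real (1 / real (Suc N)) * ((1 - z ^ Suc N) / (1 - z))" for N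
  proof -
    have "iexp (real n * t) = z ^ n" for n
      unfolding z_def exp_of_nat_mult[symmetric] by (simp add: mult_ac)
    then have "cesaro_kernel N t = of_real (1 / real (Suc N)) * (\<Sum>n\<le>N. z ^ n)"
      unfolding cesaro_kernel_def sum_distrib_left by simp
    then show ?thesis using \<open>z \<noteq> 1\<close> by (simp only: sum_gp0 if_False Suc_eq_plus1)
  qed
  have "cmod (cesaro_kernel N t) \<le> 2 / cmod (1 - z) / real N" if "N \<ge> 1" for N
  proof -
    have "cmod (1 - z ^ Suc N) \<le> 2"
      by (rule order_trans[OF norm_triangle_ineq4])
        (simp only: norm_power z_def norm_exp_i_times power_one norm_one one_add_one order_refl)
    then have "cmod ((1 - z ^ Suc N) / (1 - z)) \<le> 2 / cmod (1 - z)"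
      unfolding norm_divide by (rule divide_right_mono) simp
    then have "cmod (cesaro_kernel N t) \<le> (1 / real (Suc N)) * (2 / cmod (1 - z))"
      unfolding kernel norm_mult norm_of_real by (intro mult_mono) auto
    also have "\<dots> \<le> (1 / real N) * (2 / cmod (1 - z))"
      using that by (intro mult_right_mono) (auto simp: frac_le)
    finally show ?thesis by (simp only: mult_1 times_divide_eq_left)
  qed
  then have "(\<lambda>N. cesaro_kernel N t) \<longlonglongrightarrow> 0"
    by (intro Lim_null_comparison[OF _ lim_const_over_n[of "2 / cmod (1 - z)"]])
      (auto simp: eventually_sequentially)
  then show ?thesis using False by simp
qed

locale spectral_square_integrable_law = square_integrable_law +
  fixes \<sigma> :: "real measure"
  assumes circle: "circle_measure \<sigma>"
    and char_\<sigma>: "\<And>n::int. char \<sigma> (of_int n) = of_real (cov n)"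
begin

sublocale \<sigma>: finite_measure \<sigma>
  using circle by (simp add: circle_measure_def)

lemma sets_\<sigma>: "sets \<sigma> = sets (restrict_space borel {-pi..<pi})"
  using circle by (simp add: circle_measure_def)

lemma space_\<sigma>: "space \<sigma> = {-pi..<pi}"
  using sets_eq_imp_space_eq[OF sets_\<sigma>] by (simp add: space_restrict_space)

lemma measurable_\<sigma>: "f \<in> borel_measurable borel \<Longrightarrow> f \<in> borel_measurable \<sigma>"
  by (subst measurable_cong_sets[OF sets_\<sigma> refl]) (rule measurable_restrict_space1)

lemma singleton_0_\<sigma>: "{0} \<in> sets \<sigma>"
  unfolding sets_\<sigma> sets_restrict_space by (intro image_eqI[of _ _ "{0}"]) auto

lemma integrable_\<sigma>:
  fixes f :: "real \<Rightarrow> 'b::{banach, second_countable_topology}"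
  shows "f \<in> borel_measurable borel \<Longrightarrow> (\<And>t. norm (f t) \<le> C) \<Longrightarrow> integrable \<sigma> f"
  by (rule \<sigma>.integrable_const_bound[of _ C]) (auto intro: measurable_\<sigma>)

text \<open>The averages are integrals of the kernel times e^(i m t), and the kernel tends boundedly
  to the indicator of 0. The phase equals 1 at 0, so the limit is the same for every offset
  m.\<close>

lemma cesaro_cov_tendsto:
  "(\<lambda>N. (\<Sum>n\<le>N. cov (int n + m)) / real (Suc N)) \<longlonglongrightarrow> measure \<sigma> {0}"
proof -
  have "(\<lambda>N. \<integral>t. cesaro_kernel N t * iexp (of_int m * t) \<partial>\<sigma>) \<longlonglongrightarrow> (\<integral>t. of_real (indicator {0} t) \<partial>\<sigma>)"
  proof (rule integral_dominated_convergence[where w = "\<lambda>_. 1"])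
    have "(\<lambda>N. cesaro_kernel N t * iexp (of_int m * t)) \<longlonglongrightarrow> complex_of_real (indicator {0} t)"
      if "t \<in> {-pi..<pi}" for t
    proof -
      have "indicator {0} t * iexp (of_int m * t) = complex_of_real (indicator {0} t)"
        by (simp add: indicator_def)
      then show ?thesis
        using tendsto_mult[OF cesaro_kernel_tendsto[OF that] tendsto_const[of "iexp (of_int m * t)"]]
        by (simp only:)
    qed
    then show "AE t in \<sigma>. (\<lambda>N. cesaro_kernel N t * iexp (of_int m * t)) \<longlonglongrightarrow> of_real (indicator {0} t)"
      by (intro AE_I2) (simp only: space_\<sigma>)
    show "AE t in \<sigma>. norm (cesaro_kernel N t * iexp (of_int m * t)) \<le> 1" for N
      by (intro AE_I2) (simp add: norm_mult cmod_cesaro_kernel_le)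
    show "(\<lambda>t. complex_of_real (indicator {0} t)) \<in> borel_measurable \<sigma>"
      by (rule measurable_\<sigma>) measurable
    show "(\<lambda>t. cesaro_kernel N t * iexp (of_int m * t)) \<in> borel_measurable \<sigma>" for N
      by (rule measurable_\<sigma>) measurable
  qed (rule integrable_\<sigma>[of _ 1], auto)
  moreover have "(\<integral>t. cesaro_kernel N t * iexp (of_int m * t) \<partial>\<sigma>)
      = of_real ((\<Sum>n\<le>N. cov (int n + m)) / real (Suc N))" for N
  proof -
    have "cesaro_kernel N t * iexp (of_int m * t)
        = (\<Sum>n\<le>N. of_real (1 / real (Suc N)) * iexp (of_int (int n + m) * t))" for t
      unfolding cesaro_kernel_def sum_distrib_right mult.assoc exp_add[symmetric] distrib_left[symmetric]
        of_real_add[symmetric]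
      by (simp only: of_int_add of_int_of_nat_eq distrib_right)
    then have "(\<integral>t. cesaro_kernel N t * iexp (of_int m * t) \<partial>\<sigma>)
        = (\<Sum>n\<le>N. \<integral>t. of_real (1 / real (Suc N)) * iexp (of_int (int n + m) * t) \<partial>\<sigma>)"
      by (simp only:) (rule Bochner_Integration.integral_sum, rule integrable_mult_right,
          rule integrable_\<sigma>[of _ 1], auto)
    also have "\<dots> = (\<Sum>n\<le>N. of_real (1 / real (Suc N)) * char \<sigma> (of_int (int n + m)))"
      by (simp only: char_def integral_mult_right_zero)
    also have "\<dots> = of_real ((\<Sum>n\<le>N. cov (int n + m)) / real (Suc N))"
      unfolding char_\<sigma> of_real_mult[symmetric] of_real_sum[symmetric]
      by (simp add: sum_divide_distrib)
    finally show ?thesis .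
  qed
  moreover have "(\<integral>t. complex_of_real (indicator {0} t) \<partial>\<sigma>) = of_real (measure \<sigma> {0})"
    using singleton_0_\<sigma> by (simp only: integral_complex_of_real) simp
  ultimately show ?thesis by (simp only: tendsto_of_real_iff)
qed

lemma integrable_linear_combination_square:
  "integrable P (\<lambda>x. (\<Sum>i\<le>K. u i * (x (int i) - c))\<^sup>2)"
proof -
  have c: "integrable P (\<lambda>x. (x i - c)\<^sup>2)" for i
    using square_integrable[of i] integrable_coord[of i] by (simp add: power2_diff)
  have "integrable P (\<lambda>x. \<Sum>i\<le>K. \<Sum>j\<le>K. u i * u j * ((x (int i) - c) * (x (int j) - c)))"
    by (intro Bochner_Integration.integrable_sum integrable_mult_right
        integrable_mult_square_integrable c) measurable
  then show ?thesis by (simp add: power2_eq_square sum_product mult_ac)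
qed

text \<open>The spectral isometry on real combinations: the centred coordinate k goes to t -> e^(i k
  t), and both families have \<open>cov\<close> of the index difference as inner products.\<close>

lemma integral_linear_combination_square:
  defines "\<mu> \<equiv> (\<integral>x. x 0 \<partial>P)"
  shows "(\<integral>x. (\<Sum>i\<le>K. u i * (x (int i) - \<mu>))\<^sup>2 \<partial>P)
    = (\<integral>t. (cmod (\<Sum>i\<le>K. of_real (u i) * iexp (real i * t)))\<^sup>2 \<partial>\<sigma>)"
proof -
  have prod: "integrable P (\<lambda>x. x i * x j)" for i j
    by (intro integrable_mult_square_integrable square_integrable) measurable
  have E: "(\<integral>x. (x i - \<mu>) * (x j - \<mu>) \<partial>P) = cov (i - j)"
    and I: "integrable P (\<lambda>x. (x i - \<mu>) * (x j - \<mu>))" for i j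
  proof -
    have eq: "(x i - \<mu>) * (x j - \<mu>) = x i * x j - \<mu> * x i - \<mu> * x j + \<mu> * \<mu>" for x :: "int \<Rightarrow> real"
      by (simp add: algebra_simps)
    show "integrable P (\<lambda>x. (x i - \<mu>) * (x j - \<mu>))"
      unfolding eq using prod integrable_coord by simp
    show "(\<integral>x. (x i - \<mu>) * (x j - \<mu>) \<partial>P) = cov (i - j)"
      unfolding eq cov_eq[of i j, symmetric] using prod integrable_coord
      by (simp add: integral_coord[of i] integral_coord[of j] \<mu>_def)
  qed
  have "(\<integral>x. (\<Sum>i\<le>K. u i * (x (int i) - \<mu>))\<^sup>2 \<partial>P)
      = (\<integral>x. (\<Sum>i\<le>K. \<Sum>j\<le>K. u i * u j * ((x (int i) - \<mu>) * (x (int j) - \<mu>))) \<partial>P)"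
    unfolding power2_eq_square sum_product by (simp only: mult_ac)
  also have "\<dots> = (\<Sum>i\<le>K. \<Sum>j\<le>K. u i * u j * cov (int i - int j))"
    unfolding E[symmetric] using I
    by (simp add: Bochner_Integration.integral_sum Bochner_Integration.integrable_sum)
  finally have lhs: "(\<integral>x. (\<Sum>i\<le>K. u i * (x (int i) - \<mu>))\<^sup>2 \<partial>P)
      = (\<Sum>i\<le>K. \<Sum>j\<le>K. u i * u j * cov (int i - int j))" .
  have exp_eq: "iexp (real i * t) * cnj (iexp (real j * t)) = iexp (of_int (int i - int j) * t)" for i j t
  proof -
    have "cnj (iexp (real j * t)) = iexp (- (real j * t))"
      by (simp add: exp_cnj)
    then show ?thesis
      by (simp add: exp_add[symmetric] algebra_simps)
  qed
  have "complex_of_real (\<integral>t. (cmod (\<Sum>i\<le>K. of_real (u i) * iexp (real i * t)))\<^sup>2 \<partial>\<sigma>)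
      = (\<integral>t. of_real ((cmod (\<Sum>i\<le>K. of_real (u i) * iexp (real i * t)))\<^sup>2) \<partial>\<sigma>)"
    by (rule integral_complex_of_real[symmetric])
  also have "\<dots> = (\<integral>t. (\<Sum>i\<le>K. \<Sum>j\<le>K. of_real (u i * u j) * iexp (of_int (int i - int j) * t)) \<partial>\<sigma>)"
    unfolding complex_norm_square cnj_sum sum_product complex_cnj_mult complex_cnj_complex_of_real
      exp_eq[symmetric] by (simp only: of_real_mult mult_ac)
  also have "\<dots> = (\<Sum>i\<le>K. \<Sum>j\<le>K. of_real (u i * u j) * char \<sigma> (of_int (int i - int j)))"
  proof -
    have int: "integrable \<sigma> (\<lambda>t. iexp (of_int (int i - int j) * t))" for i j
      by (rule integrable_\<sigma>[of _ 1]) auto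
    have "(\<integral>t. (\<Sum>i\<le>K. \<Sum>j\<le>K. of_real (u i * u j) * iexp (of_int (int i - int j) * t)) \<partial>\<sigma>)
        = (\<Sum>i\<le>K. \<integral>t. (\<Sum>j\<le>K. of_real (u i * u j) * iexp (of_int (int i - int j) * t)) \<partial>\<sigma>)"
      by (intro Bochner_Integration.integral_sum Bochner_Integration.integrable_sum integrable_mult_right int)
    also have "\<dots> = (\<Sum>i\<le>K. \<Sum>j\<le>K. \<integral>t. of_real (u i * u j) * iexp (of_int (int i - int j) * t) \<partial>\<sigma>)"
      by (intro sum.cong[OF refl] Bochner_Integration.integral_sum integrable_mult_right int)
    finally show ?thesis by (simp only: char_def integral_mult_right_zero)
  qed
  also have "\<dots> = of_real (\<Sum>i\<le>K. \<Sum>j\<le>K. u i * u j * cov (int i - int j))"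
    unfolding char_\<sigma> by (simp only: of_real_mult of_real_sum)
  finally show ?thesis unfolding lhs by (simp only: of_real_eq_iff)
qed

end

section \<open>Two auxiliary facts: L^1 against L^2 norms, and almost invariant sets\<close>

lemma (in prob_space) integral_abs_le_sqrt:
  fixes u :: "'a \<Rightarrow> real"
  assumes u: "u \<in> borel_measurable M" and u2: "integrable M (\<lambda>x. (u x)\<^sup>2)"
  shows "(\<integral>x. \<bar>u x\<bar> \<partial>M) \<le> sqrt (\<integral>x. (u x)\<^sup>2 \<partial>M)"
proof (rule real_le_rsqrt)
  have "integrable M (\<lambda>x. \<bar>u x\<bar>)"
    using square_integrable_imp_integrable[OF u u2] by (rule integrable_abs)
  from variance_eq[OF this] u2 show "(\<integral>x. \<bar>u x\<bar> \<partial>M)\<^sup>2 \<le> (\<integral>x. (u x)\<^sup>2 \<partial>M)"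
    using variance_positive[of "\<lambda>x. \<bar>u x\<bar>"] by simp
qed

text \<open>The set of points visiting A infinitely often is strictly invariant, so
  \<open>ergodic_law\<close> applies to it. It differs from A by a null set, because almost every
  forward orbit stays inside A or outside A.\<close>

lemma (in stationary_law) ergodic_almost_invariant_set:
  assumes erg: "ergodic_law P" and A: "A \<in> sets path_space"
    and inv: "AE x in P. shift 1 x \<in> A \<longleftrightarrow> x \<in> A"
  shows "prob A = 0 \<or> prob A = 1"
proof -
  define A' where "A' = (\<Inter>m. \<Union>n\<in>{m..}. shift (int n) -` A)"
  have "shift (int n) -` A \<in> sets path_space" for n
    using measurable_sets[OF measurable_shift A, of "int n"] by simp
  then have A'_sets: "A' \<in> sets path_space" unfolding A'_def by (intro sets.countable_INT sets.countable_UN') auto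
  have mem: "x \<in> A' \<longleftrightarrow> (\<forall>m. \<exists>n\<ge>m. shift (int n) x \<in> A)" for x
    by (auto simp: A'_def)
  have "shift 1 x \<in> A' \<longleftrightarrow> x \<in> A'" for x
  proof
    assume L: "shift 1 x \<in> A'"
    show "x \<in> A'" unfolding mem
    proof
      fix m
      from L obtain n where "n \<ge> m" "shift (int n) (shift 1 x) \<in> A" unfolding mem by blast
      then show "\<exists>n\<ge>m. shift (int n) x \<in> A" by (intro exI[of _ "Suc n"]) (simp add: add.commute)
    qed
  next
    assume R: "x \<in> A'"
    show "shift 1 x \<in> A'" unfolding mem
    proof
      fix m
      \<comment> \<open>A visit at time m + 1 or later is requested because the clock of
        \<open>shift 1 x\<close> runs one unit behind.\<close>
      from R obtain n where "n \<ge> Suc m" "shift (int n) x \<in> A" unfolding mem by blast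
      then show "\<exists>n\<ge>m. shift (int n) (shift 1 x) \<in> A"
        by (intro exI[of _ "n - 1"]) (auto simp: of_nat_diff)
    qed
  qed
  then have "shift 1 -` A' \<inter> space P = A'" by auto
  with erg A'_sets have "prob A' = 0 \<or> prob A' = 1" unfolding ergodic_law_def sets_P by blast
  moreover have "prob A' = prob A"
  proof (rule measure_eq_AE)
    have "AE x in P. \<forall>n. shift 1 (shift (int n) x) \<in> A \<longleftrightarrow> shift (int n) x \<in> A"
      unfolding AE_all_countable using AE_shift[OF inv] by blast
    then show "AE x in P. (x \<in> A') = (x \<in> A)"
    proof eventually_elim
      case (elim x)
      have "shift (int n) x \<in> A \<longleftrightarrow> x \<in> A" for n
      proof (induction n)
        case (Suc n)
        then show ?case using elim[rule_format, of n] by (simp add: add.commute)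
      qed simp
      then show ?case unfolding mem by auto
    qed
  qed (simp_all only: sets_P A A'_sets)
  ultimately show ?thesis by simp
qed

section \<open>Time averages and their limit in L^2\<close>

context spectral_square_integrable_law
begin

definition centered_mean :: "nat \<Rightarrow> (int \<Rightarrow> real) \<Rightarrow> real" where
  "centered_mean N x = (\<Sum>n\<le>N. 1 / real (Suc N) * (x (int n) - (\<integral>y. y 0 \<partial>P)))"

definition kernel_defect :: "nat \<Rightarrow> real" where
  "kernel_defect N = (\<integral>t. (cmod (cesaro_kernel N t - indicator {0} t))\<^sup>2 \<partial>\<sigma>)"

lemma centered_mean_measurable [measurable]: "centered_mean N \<in> borel_measurable path_space"
  unfolding centered_mean_def by measurable

lemma integrable_centered_mean_square: "integrable P (\<lambda>x. (centered_mean N x)\<^sup>2)"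
  unfolding centered_mean_def by (rule integrable_linear_combination_square)

lemma integral_centered_mean_square:
  "(\<integral>x. (centered_mean N x)\<^sup>2 \<partial>P) = (\<integral>t. (cmod (cesaro_kernel N t))\<^sup>2 \<partial>\<sigma>)"
  unfolding centered_mean_def cesaro_kernel_def by (rule integral_linear_combination_square)

text \<open>Padding the weights by 0 up to the larger of \<open>N\<close> and \<open>M\<close>
  writes the difference as one linear combination, to which the isometry applies.\<close>

lemma centered_mean_diff:
  "integrable P (\<lambda>x. (centered_mean N x - centered_mean M x)\<^sup>2)" (is ?I)
  "(\<integral>x. (centered_mean N x - centered_mean M x)\<^sup>2 \<partial>P)
    = (\<integral>t. (cmod (cesaro_kernel N t - cesaro_kernel M t))\<^sup>2 \<partial>\<sigma>)" (is ?E)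
proof -
  define K where "K = max N M"
  define w where "w N i = (if i \<le> N then 1 / real (Suc N) else 0)" for N i
  define u where "u i = w N i - w M i" for i
  have F: "centered_mean L x = (\<Sum>i\<le>K. w L i * (x (int i) - (\<integral>y. y 0 \<partial>P)))" if "L \<le> K" for L x
    unfolding centered_mean_def
    using that by (intro sum.mono_neutral_cong_left) (auto simp: w_def)
  have D: "cesaro_kernel L t = (\<Sum>i\<le>K. of_real (w L i) * iexp (real i * t))" if "L \<le> K" for L t
    unfolding cesaro_kernel_def
    using that by (intro sum.mono_neutral_cong_left) (auto simp: w_def)
  have le: "N \<le> K" "M \<le> K" by (auto simp: K_def)
  have F': "centered_mean N x - centered_mean M x = (\<Sum>i\<le>K. u i * (x (int i) - (\<integral>y. y 0 \<partial>P)))" for x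
    unfolding F[OF le(1)] F[OF le(2)] u_def by (simp only: sum_subtractf left_diff_distrib)
  have D': "cesaro_kernel N t - cesaro_kernel M t = (\<Sum>i\<le>K. of_real (u i) * iexp (real i * t))" for t
    unfolding D[OF le(1)] D[OF le(2)] u_def by (simp only: sum_subtractf left_diff_distrib of_real_diff)
  show ?I unfolding F' by (rule integrable_linear_combination_square)
  show ?E unfolding F' D' by (rule integral_linear_combination_square)
qed

text \<open>Through the isometry this is the limit of the variances of the time averages, the
  quantity that ergodicity has to force to 0.\<close>

lemma kernel_square_tendsto:
  "(\<lambda>N. \<integral>t. (cmod (cesaro_kernel N t))\<^sup>2 \<partial>\<sigma>) \<longlonglongrightarrow> measure \<sigma> {0}"
proof -
  have "(\<lambda>N. \<integral>t. (cmod (cesaro_kernel N t))\<^sup>2 \<partial>\<sigma>) \<longlonglongrightarrow> (\<integral>t. indicator {0} t \<partial>\<sigma>)"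
  proof (rule integral_dominated_convergence[where w = "\<lambda>_. 1"])
    have "(\<lambda>N. (cmod (cesaro_kernel N t))\<^sup>2) \<longlonglongrightarrow> (cmod (indicator {0} t))\<^sup>2" if "t \<in> {-pi..<pi}" for t
      by (intro tendsto_intros cesaro_kernel_tendsto that)
    moreover have "(cmod (indicator {0} t))\<^sup>2 = indicator {0} t" for t :: real by (simp add: indicator_def)
    ultimately show "AE t in \<sigma>. (\<lambda>N. (cmod (cesaro_kernel N t))\<^sup>2) \<longlonglongrightarrow> indicator {0} t"
      by (intro AE_I2) (simp only: space_\<sigma>)
    show "AE t in \<sigma>. norm ((cmod (cesaro_kernel N t))\<^sup>2) \<le> 1" for N
      using cmod_cesaro_kernel_le by (intro AE_I2) (simp add: power_le_one)
    show "indicator {0} \<in> borel_measurable \<sigma>" by (rule measurable_\<sigma>) measurable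
    show "(\<lambda>t. (cmod (cesaro_kernel N t))\<^sup>2) \<in> borel_measurable \<sigma>" for N by (rule measurable_\<sigma>) measurable
  qed simp
  then show ?thesis using singleton_0_\<sigma> by simp
qed

lemma integrable_kernel_defect: "integrable \<sigma> (\<lambda>t. (cmod (cesaro_kernel N t - indicator {0} t))\<^sup>2)"
  and kernel_defect_bound: "(cmod (cesaro_kernel N t - indicator {0} t))\<^sup>2 \<le> 4"
proof -
  show bound: "(cmod (cesaro_kernel N t - indicator {0} t))\<^sup>2 \<le> 4" for t
  proof -
    have "cmod (cesaro_kernel N t - indicator {0} t) \<le> 1 + 1"
      by (intro order_trans[OF norm_triangle_ineq4] add_mono cmod_cesaro_kernel_le) (simp add: indicator_def)
    then show ?thesis using power_mono[of _ "2::real" 2] by fastforce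
  qed
  show "integrable \<sigma> (\<lambda>t. (cmod (cesaro_kernel N t - indicator {0} t))\<^sup>2)"
    by (rule integrable_\<sigma>[of _ 4]) (measurable, simp add: bound)
qed

lemma kernel_defect_tendsto: "kernel_defect \<longlonglongrightarrow> 0"
proof -
  have "(\<lambda>N. \<integral>t. (cmod (cesaro_kernel N t - indicator {0} t))\<^sup>2 \<partial>\<sigma>) \<longlonglongrightarrow> (\<integral>t. 0 \<partial>\<sigma>)"
  proof (rule integral_dominated_convergence[where w = "\<lambda>_. 4"])
    have "(\<lambda>N. (cmod (cesaro_kernel N t - indicator {0} t))\<^sup>2)
        \<longlonglongrightarrow> (cmod (indicator {0} t - indicator {0} t))\<^sup>2" if "t \<in> {-pi..<pi}" for t
      by (intro tendsto_power tendsto_norm tendsto_diff cesaro_kernel_tendsto that tendsto_const)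
    then have "(\<lambda>N. (cmod (cesaro_kernel N t - indicator {0} t))\<^sup>2) \<longlonglongrightarrow> 0" if "t \<in> {-pi..<pi}" for t
      using that by simp
    then show "AE t in \<sigma>. (\<lambda>N. (cmod (cesaro_kernel N t - indicator {0} t))\<^sup>2) \<longlonglongrightarrow> 0"
      by (intro AE_I2) (simp only: space_\<sigma>)
    show "AE t in \<sigma>. norm ((cmod (cesaro_kernel N t - indicator {0} t))\<^sup>2) \<le> 4" for N
      by (intro AE_I2) (simp add: kernel_defect_bound)
  qed (use integrable_kernel_defect in auto)
  then show ?thesis unfolding kernel_defect_def[abs_def] by simp
qed

text \<open>After the isometry, the triangle inequality through the common limit, the indicator of
  0, combined with (a + b)^2 \<le> 2 a^2 + 2 b^2.\<close>

lemma centered_mean_diff_le: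
  "(\<integral>x. (centered_mean N x - centered_mean M x)\<^sup>2 \<partial>P) \<le> 2 * kernel_defect N + 2 * kernel_defect M"
proof -
  have "(cmod (a - b))\<^sup>2 \<le> 2 * (cmod (a - c))\<^sup>2 + 2 * (cmod (b - c))\<^sup>2" for a b c :: complex
  proof -
    have "cmod (a - b) \<le> cmod (a - c) + cmod (b - c)"
      using norm_triangle_ineq4[of "a - c" "b - c"] by simp
    then have "(cmod (a - b))\<^sup>2 \<le> (cmod (a - c) + cmod (b - c))\<^sup>2" by (intro power_mono) auto
    also have "\<dots> \<le> 2 * (cmod (a - c))\<^sup>2 + 2 * (cmod (b - c))\<^sup>2"
      using sum_squares_bound[of "cmod (a - c)" "cmod (b - c)"] by (simp add: power2_sum)
    finally show ?thesis .
  qed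
  then have "(\<integral>t. (cmod (cesaro_kernel N t - cesaro_kernel M t))\<^sup>2 \<partial>\<sigma>)
      \<le> (\<integral>t. 2 * (cmod (cesaro_kernel N t - indicator {0} t))\<^sup>2
          + 2 * (cmod (cesaro_kernel M t - indicator {0} t))\<^sup>2 \<partial>\<sigma>)"
    by (intro integral_mono_AE' AE_I2 Bochner_Integration.integrable_add integrable_mult_right
        integrable_kernel_defect) auto
  also have "\<dots> = 2 * kernel_defect N + 2 * kernel_defect M"
    unfolding kernel_defect_def using integrable_kernel_defect by simp
  finally show ?thesis unfolding centered_mean_diff(2) .
qed

text \<open>The mean ergodic theorem for \<open>x 0\<close>, with the Cauchy property read off the spectral measure.\<close>

lemma centered_mean_limit:
  obtains g r where "g \<in> borel_measurable path_space" "strict_mono r"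
    "\<And>k. integrable P (\<lambda>x. (centered_mean (r k) x - g x)\<^sup>2)"
    "(\<lambda>k. \<integral>x. (centered_mean (r k) x - g x)\<^sup>2 \<partial>P) \<longlonglongrightarrow> 0"
proof -
  let ?F = centered_mean and ?d = kernel_defect
  have d_nonneg: "0 \<le> ?d N" for N by (simp add: kernel_defect_def)
  have F1: "integrable P (?F N)" for N
    by (rule square_integrable_imp_integrable[OF _ integrable_centered_mean_square]) measurable
  have "\<exists>N. \<forall>i\<ge>N. \<forall>j\<ge>N. (\<integral>x. norm (?F i x - ?F j x) \<partial>P) < e" if "e > 0" for e
  proof -
    \<comment> \<open>The squared L^2 distance is at most twice the sum of the two defects, so e^2 /
      4 for each gives e^2, and e for the L^1 distance.\<close>
    have "\<forall>\<^sub>F N in sequentially. ?d N < e\<^sup>2 / 4"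
      using kernel_defect_tendsto \<open>e > 0\<close> by (intro order_tendstoD(2)) auto
    then obtain N where N: "\<And>i. i \<ge> N \<Longrightarrow> ?d i < e\<^sup>2 / 4" by (auto simp: eventually_sequentially)
    have "(\<integral>x. norm (?F i x - ?F j x) \<partial>P) < e" if "i \<ge> N" "j \<ge> N" for i j
    proof -
      have "(\<integral>x. norm (?F i x - ?F j x) \<partial>P) \<le> sqrt (\<integral>x. (?F i x - ?F j x)\<^sup>2 \<partial>P)"
        unfolding real_norm_def by (rule integral_abs_le_sqrt[OF _ centered_mean_diff(1)]) measurable
      also have "\<dots> < sqrt (e\<^sup>2)"
        using centered_mean_diff_le[of i j] N[OF that(1)] N[OF that(2)]
        by (intro real_sqrt_less_mono) linarith
      finally show ?thesis using \<open>e > 0\<close> by simp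
    qed
    then show ?thesis by blast
  qed
  from cauchy_L1_AE_cauchy_subseq[OF F1 this] obtain r where r: "strict_mono r"
    and C: "AE x in P. Cauchy (\<lambda>k. ?F (r k) x)" by blast
  \<comment> \<open>Where the subsequence does not converge \<open>lim\<close> has an unspecified
    value; such points form a null set.\<close>
  define g where "g x = lim (\<lambda>k. ?F (r k) x)" for x
  have g [measurable]: "g \<in> borel_measurable path_space" unfolding g_def by measurable
  have lim: "AE x in P. (\<lambda>k. ?F (r k) x) \<longlonglongrightarrow> g x"
    using C by eventually_elim (simp add: g_def Cauchy_convergent_iff convergent_LIMSEQ_iff)
  have d_lim: "(\<lambda>k. ?d (r k)) \<longlonglongrightarrow> 0"
    using LIMSEQ_subseq_LIMSEQ[OF kernel_defect_tendsto r] by (simp add: o_def)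
  \<comment> \<open>The limit was obtained almost surely, from an L^1 estimate; Fatou's lemma in j
    with k fixed recovers the L^2 estimate.\<close>
  have nn: "(\<integral>\<^sup>+x. ennreal ((?F (r k) x - g x)\<^sup>2) \<partial>P) \<le> ennreal (2 * ?d (r k))" for k
  proof -
    have "AE x in P. liminf (\<lambda>j. ennreal ((?F (r k) x - ?F (r j) x)\<^sup>2)) = ennreal ((?F (r k) x - g x)\<^sup>2)"
      using lim
    proof eventually_elim
      case (elim x)
      then have "(\<lambda>j. ennreal ((?F (r k) x - ?F (r j) x)\<^sup>2)) \<longlonglongrightarrow> ennreal ((?F (r k) x - g x)\<^sup>2)"
        by (intro tendsto_ennrealI tendsto_power tendsto_diff tendsto_const)
      then show ?case by (intro lim_imp_Liminf) simp_all
    qed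
    then have "(\<integral>\<^sup>+x. ennreal ((?F (r k) x - g x)\<^sup>2) \<partial>P)
        = (\<integral>\<^sup>+x. liminf (\<lambda>j. ennreal ((?F (r k) x - ?F (r j) x)\<^sup>2)) \<partial>P)"
      by (intro nn_integral_cong_AE) auto
    also have "\<dots> \<le> liminf (\<lambda>j. \<integral>\<^sup>+x. ennreal ((?F (r k) x - ?F (r j) x)\<^sup>2) \<partial>P)"
      by (rule nn_integral_liminf) measurable
    also have "\<dots> \<le> liminf (\<lambda>j. ennreal (2 * ?d (r k) + 2 * ?d (r j)))"
    proof (rule Liminf_mono, rule always_eventually, rule allI)
      fix j
      have "(\<integral>\<^sup>+x. ennreal ((?F (r k) x - ?F (r j) x)\<^sup>2) \<partial>P)
          = ennreal (\<integral>x. (?F (r k) x - ?F (r j) x)\<^sup>2 \<partial>P)"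
        by (rule nn_integral_eq_integral[OF centered_mean_diff(1)]) simp
      then show "(\<integral>\<^sup>+x. ennreal ((?F (r k) x - ?F (r j) x)\<^sup>2) \<partial>P) \<le> ennreal (2 * ?d (r k) + 2 * ?d (r j))"
        using centered_mean_diff_le by (simp add: ennreal_leI)
    qed
    also have "\<dots> = ennreal (2 * ?d (r k) + 2 * 0)"
      by (intro lim_imp_Liminf tendsto_ennrealI tendsto_intros d_lim) simp
    finally show ?thesis by simp
  qed
  have int: "integrable P (\<lambda>x. (?F (r k) x - g x)\<^sup>2)" for k
    by (rule integrableI_nonneg) (use nn[of k] in \<open>auto simp: less_top[symmetric] top_unique intro: order_le_less_trans\<close>)
  have le: "(\<integral>x. (?F (r k) x - g x)\<^sup>2 \<partial>P) \<le> 2 * ?d (r k)" for k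
    using nn[of k] d_nonneg by (subst (asm) nn_integral_eq_integral[OF int]) (auto simp: ennreal_le_iff)
  have "(\<lambda>k. \<integral>x. (?F (r k) x - g x)\<^sup>2 \<partial>P) \<longlonglongrightarrow> 0"
  proof (rule real_tendsto_sandwich[OF _ _ tendsto_const])
    show "(\<lambda>k. 2 * ?d (r k)) \<longlonglongrightarrow> 0" using tendsto_mult[OF tendsto_const d_lim, of 2] by simp
  qed (auto intro!: always_eventually le)
  from that[OF g r int this] show ?thesis .
qed

text \<open>Along a subsequence the time averages converge in L^2 to an almost surely invariant g of
  mean 0. Ergodicity fixes the sign of g, so g = 0 almost surely. The second moments of the averages
  then tend to 0, while by the isometry they tend to the mass of \<sigma> at 0.\<close>

lemma measure_0_if_ergodic_law:
  assumes "ergodic_law P"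
  shows "measure \<sigma> {0} = 0"
proof -
  let ?F = centered_mean
  obtain g r where g [measurable]: "g \<in> borel_measurable path_space" and r: "strict_mono r"
    and int2: "\<And>k. integrable P (\<lambda>x. (?F (r k) x - g x)\<^sup>2)"
    and lim2: "(\<lambda>k. \<integral>x. (?F (r k) x - g x)\<^sup>2 \<partial>P) \<longlonglongrightarrow> 0"
    by (rule centered_mean_limit) blast
  define \<eta> where "\<eta> k = (\<integral>x. \<bar>?F (r k) x - g x\<bar> \<partial>P)" for k
  have \<eta>: "\<eta> \<longlonglongrightarrow> 0"
  proof (rule real_tendsto_sandwich[OF _ _ tendsto_const])
    show "(\<lambda>k. sqrt (\<integral>x. (?F (r k) x - g x)\<^sup>2 \<partial>P)) \<longlonglongrightarrow> 0"
      using tendsto_real_sqrt[OF lim2] by simp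
    show "\<forall>\<^sub>F k in sequentially. \<eta> k \<le> sqrt (\<integral>x. (?F (r k) x - g x)\<^sup>2 \<partial>P)"
      unfolding \<eta>_def by (intro always_eventually allI integral_abs_le_sqrt int2) measurable
    show "\<forall>\<^sub>F k in sequentially. 0 \<le> \<eta> k" by (simp add: \<eta>_def)
  qed
  have F1: "integrable P (?F N)" for N
    by (rule square_integrable_imp_integrable[OF _ integrable_centered_mean_square]) measurable
  have D1: "integrable P (\<lambda>x. ?F (r k) x - g x)" for k
    by (rule square_integrable_imp_integrable[OF _ int2]) measurable
  have g1: "integrable P g"
    using Bochner_Integration.integrable_diff[OF F1 D1, of "r 0" 0] by simp
  have F0: "(\<integral>x. ?F N x \<partial>P) = 0" for N
  proof -
    have "(\<integral>x. x (int n) - (\<integral>y. y 0 \<partial>P) \<partial>P) = 0" for n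
      using integrable_coord integral_coord[of "int n"] by simp
    then show ?thesis
      unfolding centered_mean_def using integrable_coord
      by (subst Bochner_Integration.integral_sum) (simp_all only: integral_mult_right_zero mult_zero_right
          sum.neutral_const integrable_mult_right Bochner_Integration.integrable_diff integrable_const)
  qed
  have g0: "(\<integral>x. g x \<partial>P) = 0"
  proof -
    have "\<bar>\<integral>x. g x \<partial>P\<bar> \<le> \<eta> k" for k
    proof -
      have "(\<integral>x. ?F (r k) x - g x \<partial>P) = - (\<integral>x. g x \<partial>P)"
        using F1 g1 by (simp add: F0)
      then show ?thesis using integral_abs_bound[of P "\<lambda>x. ?F (r k) x - g x"] by (simp add: \<eta>_def)
    qed
    then have "\<bar>\<integral>x. g x \<partial>P\<bar> \<le> 0" by (intro LIMSEQ_le_const[OF \<eta>]) auto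
    then show ?thesis by simp
  qed
  define c where "c = 2 * (\<integral>x. \<bar>x 0 - (\<integral>y. y 0 \<partial>P)\<bar> \<partial>P)"
  \<comment> \<open>The sum telescopes: the shifted average differs from the average by two end
    terms divided by N + 1, and \<open>c\<close> bounds the mean absolute value of their
    difference.\<close>
  have F_shift: "(\<integral>x. \<bar>?F N (shift 1 x) - ?F N x\<bar> \<partial>P) \<le> c / real N" if "N \<ge> 1" for N
  proof -
    define m where "m = (\<integral>y. y 0 \<partial>P)"
    have "?F N (shift 1 x) - ?F N x = 1 / real (Suc N) * ((x (int (Suc N)) - m) - (x 0 - m))" for x
    proof -
      have succ: "shift 1 x (int n) = x (int (Suc n))" for n
        by (simp add: shift_def add.commute)
      have "?F N (shift 1 x) - ?F N x
          = 1 / real (Suc N) * (\<Sum>n\<le>N. (x (int (Suc n)) - m) - (x (int n) - m))"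
        unfolding centered_mean_def succ sum_subtractf[symmetric] sum_distrib_left m_def
        by (simp only: right_diff_distrib)
      also have "(\<Sum>n\<le>N. (x (int (Suc n)) - m) - (x (int n) - m)) = (x (int (Suc N)) - m) - (x 0 - m)"
        by (induction N) (simp_all add: algebra_simps)
      finally show ?thesis .
    qed
    then have eq: "\<bar>?F N (shift 1 x) - ?F N x\<bar>
        = 1 / real (Suc N) * \<bar>(x (int (Suc N)) - m) - (x 0 - m)\<bar>" for x
      by (simp only: abs_mult) simp
    have i: "integrable P (\<lambda>x. \<bar>x i - m\<bar>)" for i
      using integrable_coord by simp
    have m_shift: "(\<integral>x. \<bar>x i - m\<bar> \<partial>P) = c / 2" for i
    proof -
      have "(\<lambda>x::int \<Rightarrow> real. \<bar>x 0 - m\<bar>) \<in> borel_measurable path_space" by measurable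
      from integral_shift[OF this, of i] show ?thesis by (simp add: shift_def c_def m_def)
    qed
    have "(\<integral>x. \<bar>(x (int (Suc N)) - m) - (x 0 - m)\<bar> \<partial>P)
        \<le> (\<integral>x. \<bar>x (int (Suc N)) - m\<bar> + \<bar>x 0 - m\<bar> \<partial>P)"
      by (intro integral_mono_AE' AE_I2 Bochner_Integration.integrable_add i abs_triangle_ineq4) simp
    also have "\<dots> = c" using i by (simp only: Bochner_Integration.integral_add m_shift field_sum_of_halves)
    finally have "(\<integral>x. \<bar>?F N (shift 1 x) - ?F N x\<bar> \<partial>P) \<le> 1 / real (Suc N) * c"
      unfolding eq integral_mult_right_zero by (intro mult_left_mono) auto
    also have "\<dots> \<le> c / real N"
    proof -
      have "c \<ge> 0" by (simp add: c_def)
      then show ?thesis using that by (simp add: frac_le)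
    qed
    finally show ?thesis .
  qed
  have inv: "AE x in P. g (shift 1 x) = g x"
  proof -
    have gT: "integrable P (\<lambda>x. g (shift 1 x))" by (rule integrable_shift[OF g1])
    have FT: "integrable P (\<lambda>x. ?F N (shift 1 x))" for N by (rule integrable_shift[OF F1])
    \<comment> \<open>Three comparisons: g with the average after the shift, the shifted average
      with the average, the average with g. The first and the last cost the same by
      stationarity.\<close>
    have bound: "(\<integral>x. \<bar>g (shift 1 x) - g x\<bar> \<partial>P) \<le> \<eta> k + c / real k + \<eta> k" if "k \<ge> 1" for k
    proof -
      \<comment> \<open>A strictly increasing \<open>r\<close> dominates the identity, so
        \<open>c / r k\<close> may be weakened to \<open>c / k\<close>.\<close>
      have rk: "k \<le> r k" using r by (rule seq_suble)
      have "c \<ge> 0" by (simp add: c_def)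
      have "(\<integral>x. \<bar>g (shift 1 x) - g x\<bar> \<partial>P)
          \<le> (\<integral>x. \<bar>?F (r k) (shift 1 x) - g (shift 1 x)\<bar> + \<bar>?F (r k) (shift 1 x) - ?F (r k) x\<bar>
              + \<bar>?F (r k) x - g x\<bar> \<partial>P)"
        using gT g1 FT F1 by (intro integral_mono) auto
      also have "\<dots> = (\<integral>x. \<bar>?F (r k) (shift 1 x) - g (shift 1 x)\<bar> \<partial>P)
          + (\<integral>x. \<bar>?F (r k) (shift 1 x) - ?F (r k) x\<bar> \<partial>P) + \<eta> k"
        unfolding \<eta>_def using gT g1 FT F1 by simp
      also have "(\<integral>x. \<bar>?F (r k) (shift 1 x) - g (shift 1 x)\<bar> \<partial>P) = \<eta> k"
        unfolding \<eta>_def by (rule integral_shift) measurable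
      also have "(\<integral>x. \<bar>?F (r k) (shift 1 x) - ?F (r k) x\<bar> \<partial>P) \<le> c / real k"
      proof -
        have "c / real (r k) \<le> c / real k"
          using rk that \<open>c \<ge> 0\<close> by (intro divide_left_mono) auto
        then show ?thesis using F_shift[of "r k"] rk that by simp
      qed
      finally show ?thesis by simp
    qed
    have "(\<lambda>k. \<eta> k + c / real k + \<eta> k) \<longlonglongrightarrow> 0 + 0 + 0"
      by (intro tendsto_add \<eta> lim_const_over_n)
    then have "(\<integral>x. \<bar>g (shift 1 x) - g x\<bar> \<partial>P) \<le> 0"
      by (intro LIMSEQ_le_const) (use bound in auto)
    then have "(\<integral>x. \<bar>g (shift 1 x) - g x\<bar> \<partial>P) = 0"
      by (intro antisym) simp_all
    then have "AE x in P. \<bar>g (shift 1 x) - g x\<bar> = 0"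
      using gT g1 by (subst (asm) integral_nonneg_eq_0_iff_AE) auto
    then show ?thesis by simp
  qed
  have "{x \<in> space path_space. g x > 0} \<in> sets path_space" by measurable
  then have pos_sets: "{x. g x > 0} \<in> sets path_space" by simp
  \<comment> \<open>One level set suffices: it decides the sign of g almost surely, and the
    vanishing integral does the rest.\<close>
  have "AE x in P. shift 1 x \<in> {x. g x > 0} \<longleftrightarrow> x \<in> {x. g x > 0}"
    using inv by eventually_elim simp
  then have "prob {x. g x > 0} = 0 \<or> prob {x. g x > 0} = 1"
    by (rule ergodic_almost_invariant_set[OF assms pos_sets])
  then have "(AE x in P. g x \<le> 0) \<or> (AE x in P. 0 \<le> g x)"
  proof
    assume "prob {x. g x > 0} = 0"
    then have "AE x in P. x \<notin> {x. g x > 0}" using pos_sets by (subst (asm) prob_eq_0) (simp_all add: sets_P)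
    then show ?thesis by (simp add: not_less)
  next
    assume "prob {x. g x > 0} = 1"
    then have "AE x in P. x \<in> {x. g x > 0}" using pos_sets by (subst (asm) prob_eq_1) (simp_all add: sets_P)
    then have "AE x in P. 0 \<le> g x" by eventually_elim simp
    then show ?thesis ..
  qed
  then have "AE x in P. g x = 0"
  proof
    assume "AE x in P. g x \<le> 0"
    then have "AE x in P. - g x = 0"
      using g0 g1 by (subst integral_nonneg_eq_0_iff_AE[symmetric]) auto
    then show ?thesis by simp
  next
    assume "AE x in P. 0 \<le> g x"
    then show ?thesis
      using g0 g1 by (subst integral_nonneg_eq_0_iff_AE[symmetric]) auto
  qed
  then have "(\<integral>x. (?F (r k) x - g x)\<^sup>2 \<partial>P) = (\<integral>x. (?F (r k) x)\<^sup>2 \<partial>P)" for k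
    by (intro integral_cong_AE) auto
  then have "(\<lambda>k. \<integral>x. (?F (r k) x)\<^sup>2 \<partial>P) \<longlonglongrightarrow> 0" using lim2 by simp
  moreover have "(\<lambda>k. \<integral>x. (?F (r k) x)\<^sup>2 \<partial>P) \<longlonglongrightarrow> measure \<sigma> {0}"
    unfolding integral_centered_mean_square
    using LIMSEQ_subseq_LIMSEQ[OF kernel_square_tendsto r] by (simp add: o_def)
  ultimately show ?thesis by (rule LIMSEQ_unique[symmetric])
qed

text \<open>\<open>cov\<close> is even, so the two-sided limit is the one along the naturals, read
  through \<open>int\<close> in one direction and through \<open>nat \<bar>n\<bar>\<close> in the
  other.\<close>

lemma rajchman_iff_cov_tendsto_0: "rajchman \<sigma> \<longleftrightarrow> (\<lambda>n. cov (int n)) \<longlonglongrightarrow> 0"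
proof
  assume "rajchman \<sigma>"
  then have "((\<lambda>n::int. complex_of_real (cov n)) \<longlongrightarrow> of_real 0) (filtercomap (\<lambda>n::int. \<bar>n\<bar>) at_top)"
    unfolding rajchman_def char_\<sigma> by simp
  then have lim: "((\<lambda>n::int. cov n) \<longlongrightarrow> 0) (filtercomap (\<lambda>n::int. \<bar>n\<bar>) at_top)"
    by (simp only: tendsto_of_real_iff)
  have "filterlim int (filtercomap (\<lambda>n::int. \<bar>n\<bar>) at_top) sequentially"
    unfolding filterlim_filtercomap_iff o_def by (simp add: filterlim_int_sequentially)
  from filterlim_compose[OF lim this] show "(\<lambda>n. cov (int n)) \<longlonglongrightarrow> 0" .
next
  assume lim: "(\<lambda>n. cov (int n)) \<longlonglongrightarrow> 0"
  have "filterlim (\<lambda>n::int. nat \<bar>n\<bar>) sequentially (filtercomap (\<lambda>n::int. \<bar>n\<bar>) at_top)"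
    by (rule filterlim_compose[OF filterlim_nat_sequentially filterlim_filtercomap])
  from filterlim_compose[OF lim this]
  have "((\<lambda>n::int. cov (int (nat \<bar>n\<bar>))) \<longlongrightarrow> 0) (filtercomap (\<lambda>n::int. \<bar>n\<bar>) at_top)" .
  moreover have "cov (int (nat \<bar>n\<bar>)) = cov n" for n
    using cov_minus[of n] by (cases "n \<ge> 0") simp_all
  ultimately have "((\<lambda>n::int. complex_of_real (cov n)) \<longlongrightarrow> of_real 0) (filtercomap (\<lambda>n::int. \<bar>n\<bar>) at_top)"
    by (simp only: tendsto_of_real_iff)
  then show "rajchman \<sigma>"
    unfolding rajchman_def char_\<sigma> using circle by simp
qed

end

theorem proposition7p3:
  fixes M :: "'a measure" and X :: "int \<Rightarrow> 'a \<Rightarrow> real" and \<sigma> :: "real measure"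
  assumes "prob_space M"
    and "\<And>n. X n \<in> borel_measurable M"
    and "\<And>n. integrable M (\<lambda>\<omega>. (X n \<omega>)\<^sup>2)"
    and "stationary_IDp (process_law M X)"
    and "\<exists>\<epsilon>\<in>{- 1, 1::real}. \<exists>d::real. AE \<omega> in M. \<epsilon> * X 0 \<omega> + d \<ge> 0"
    and "is_spectral_measure (process_law M X)
           (\<lambda>x. complex_of_real (x 0 - (\<integral>\<omega>. X 0 \<omega> \<partial>M))) \<sigma>"
  shows "(ergodic_law (process_law M X) \<longleftrightarrow> measure \<sigma> {0} = 0) \<and>
         (mixing_law (process_law M X) \<longleftrightarrow> rajchman \<sigma>)"
proof -
  let ?P = "process_law M X"
  note [measurable] = assms(2)
  interpret M: prob_space M by fact
  have path [measurable]: "(\<lambda>\<omega> n. X n \<omega>) \<in> M \<rightarrow>\<^sub>M path_space"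
    unfolding path_space_def by (rule measurable_PiM_single') auto
  interpret P: prob_space ?P
    unfolding process_law_def by (rule M.prob_space_distr[OF path])
  interpret square_integrable_law ?P
  proof
    show "sets ?P = sets path_space" by (simp add: process_law_def)
    show "shift_invariant ?P" using assms(4) by (simp add: stationary_IDp_def)
    show "integrable ?P (\<lambda>x. (x 0)\<^sup>2)"
      unfolding process_law_def by (subst integrable_distr_eq[OF path]) (simp_all add: assms(3))
  qed
  have mean: "(\<integral>\<omega>. X 0 \<omega> \<partial>M) = (\<integral>x. x 0 \<partial>?P)"
    unfolding process_law_def by (subst integral_distr[OF path]) simp_all
  define \<mu> where "\<mu> = (\<integral>x. x 0 \<partial>?P)"
  \<comment> \<open>The centred coordinate is real, so the conjugate disappears and the Fourier
    coefficient is the covariance at lag n.\<close>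
  have char_eq: "char \<sigma> (of_int n) = of_real (cov n)" for n :: int
  proof -
    have "char \<sigma> (of_int n) = (\<integral>x. complex_of_real ((x n - \<mu>) * (x 0 - \<mu>)) \<partial>?P)"
      using assms(6) by (simp add: is_spectral_measure_def mean \<mu>_def shift_def)
    also have "\<dots> = of_real (\<integral>x. (x n - \<mu>) * (x 0 - \<mu>) \<partial>?P)"
      by (rule integral_complex_of_real)
    also have "(\<integral>x. (x n - \<mu>) * (x 0 - \<mu>) \<partial>?P) = cov n"
    proof -
      have prod: "integrable ?P (\<lambda>x. x n * x 0)"
        by (intro integrable_mult_square_integrable square_integrable) measurable
      have eq: "(x n - \<mu>) * (x 0 - \<mu>) = x n * x 0 - \<mu> * x n - \<mu> * x 0 + \<mu> * \<mu>" for x :: "int \<Rightarrow> real"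
        by (simp add: algebra_simps)
      show ?thesis
        unfolding eq cov_def using prod integrable_coord
        by (simp add: integral_coord[of n] \<mu>_def power2_eq_square)
    qed
    finally show ?thesis .
  qed
  interpret spectral_square_integrable_law ?P \<sigma>
    by unfold_locales (use assms(6) char_eq in \<open>auto simp: is_spectral_measure_def\<close>)
  have inf_div: "infinitely_divisible ?P" using assms(4) by (simp add: stationary_IDp_def)
  obtain \<epsilon> d :: real where \<epsilon>: "\<epsilon> \<in> {-1, 1}" and "AE \<omega> in M. \<epsilon> * X 0 \<omega> + d \<ge> 0"
    using assms(5) by blast
  moreover have "{x \<in> space path_space. \<epsilon> * x 0 + d \<ge> 0} \<in> sets path_space" by measurable
  ultimately have nonneg: "AE x in ?P. \<epsilon> * x 0 + d \<ge> 0"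
    unfolding process_law_def by (subst AE_distr_iff[OF path]) simp_all
  have "ergodic_law ?P" if "measure \<sigma> {0} = 0"
    using ergodic_law_if_cesaro_cov_tendsto_0[OF inf_div \<epsilon> nonneg] cesaro_cov_tendsto
    unfolding that by blast
  moreover have "mixing_law ?P \<longleftrightarrow> (\<lambda>n. cov (int n)) \<longlonglongrightarrow> 0"
    using mixing_law_if_cov_tendsto_0[OF inf_div \<epsilon> nonneg] cov_tendsto_0_if_mixing_law by blast
  ultimately show ?thesis
    using measure_0_if_ergodic_law rajchman_iff_cov_tendsto_0 by blast
qed

end
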